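(* Let $k \ge 4$ be an integer, and let $t$ be a positive integer. Then \[ f_k(n,t) = \begin{cases} t & \text{for } t \le 2, \\ \Theta(\log\log n) & \text{for } 3 \le t \le 2^{\lceil \log_2 k\rceil}, \\ \Theta(\sqrt{\log n}) & \text{for } 2^{\lceil \log_2 k\rceil} < t \le \min\{2k,\, 2^{\lceil \log_2 k\rceil}+4\}, \\ \Theta(\log n) & \text{for } 2^{k-1} < t \le k!. \end{cases} \]
   Context: Let $[n]=\{1,\dots,n\}$. A permutation $\rho$ of a finite set $X$ is a total order $<_\rho$ of the elements of $X$; if $Y\subseteq X$, then $\rho$ induces a permutation on $Y$ by restricting the order. For $t\ge 1$, a family $\mathcal{P}$ of permutations of $[n]$ $t$-shatters a set $X\subseteq[n]$ if the permutations of $\mathcal{P}$ induce at least $t$ distinct permutations on $X$. For $n \ge k$, $f_k(n,t)$ denotes the minimum number of permutations in a family of permutations of $[n]$ that $t$-shatters every subset of $[n]$ of size $k$. Asymptotic notation is for $k$ and $t$ fixed and $n\to\infty$; the implied constants may depend on $k$ and $t$. *)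

theory Defs
  imports Complex_Main "HOL-Library.Landau_Symbols"
begin

(* A permutation of X is a total order of the elements of X, represented by its reflexive
   order relation; linear_order_on X r includes r \<subseteq> X \<times> X, so distinct relations are
   distinct permutations. *)
definition perms :: "'a set \<Rightarrow> 'a rel set" where
  "perms X = {r. linear_order_on X r}"

definition induced_perm :: "'a rel \<Rightarrow> 'a set \<Rightarrow> 'a rel" where
  "induced_perm r Y = r \<inter> Y \<times> Y"

definition shatters :: "nat \<Rightarrow> 'a rel set \<Rightarrow> 'a set \<Rightarrow> bool" where
  "shatters t P X \<longleftrightarrow> t \<le> card ((\<lambda>r. induced_perm r X) ` P)"

(* Meaningful for n \<ge> k and t \<le> fact k, in which case perms {1..n} itself is such a family. *)
definition shatter_num :: "nat \<Rightarrow> nat \<Rightarrow> nat \<Rightarrow> nat" where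
  "shatter_num k n t = (LEAST m. \<exists>P. P \<subseteq> perms {1..n} \<and> card P = m \<and>
                (\<forall>X. X \<subseteq> {1..n} \<and> card X = k \<longrightarrow> shatters t P X))"

end

theory Submission
  imports Defs "HOL-Library.List_Lexorder" "HOL-Library.FuncSet" "HOL-Combinatorics.Permutations"
begin

text \<open>
Let \<open>L\<close> be the least exponent with \<open>k \<le> 2 ^ L\<close>, and let \<open>m\<close> be the number of permutations in a family.

Each lower bound finds, in any family that is small against \<open>n\<close>, a set of \<open>k\<close> points with few
patterns. By Erdos-Szekeres, applied once per permutation, some \<open>k\<close> points are monotone in every
permutation as soon as \<open>n\<close> exceeds \<open>(k - 1) ^ 2 ^ m\<close>; such points have two patterns
(\<open>card_le_if_shatters_three\<close>). Picking points one at a time, and keeping after each choice only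
the most frequent way of lying above or below the chosen point, gives \<open>k\<close> points with
\<open>2 ^ (k - 1)\<close> patterns at a cost of a factor about \<open>2 ^ m\<close> per point
(\<open>card_less_if_shatters_many\<close>). Finally, halving repeatedly produces \<open>2 ^ d\<close> large sets that every
permutation keeps apart, at a cost of \<open>2 ^ (m + 1)\<close> for each of the \<open>d\<close> rounds; with \<open>d\<close> linear in
\<open>m\<close> there are more such sets than types of balanced binary trees inside them, so two trees of equal
type can be joined into a deeper one. After \<open>L\<close> joins there are \<open>2 ^ L\<close> points with only \<open>2 ^ L\<close>
patterns, and \<open>n\<close> had to be no more than exponential in \<open>m\<^sup>2\<close>; this is where the square root of the
logarithm comes from (\<open>card_less_if_shatters_above_tree\<close>).

For the upper bounds the points are coded by binary words of length \<open>D\<close>, about \<open>log 2 n\<close>, and ordered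
lexicographically after reversing some positions. A set \<open>X\<close> of \<open>k\<close> words is the leaf set of a
binary tree, and the tree branches at \<open>L\<close> or more different positions, called the levels of \<open>X\<close>.
Reversing different sets of levels produces different patterns, so \<open>2 ^ L\<close> patterns arise from a family
of reversals that realises every choice on \<open>2 * L\<close> prescribed places, and such families have
logarithmic size in \<open>D\<close> (\<open>card_flip_patterns_ge\<close>). Reading a point as a single letter and ranking
letters arbitrarily gives all \<open>fact k\<close> patterns with logarithmically many permutations.

Between these, cut a word of length \<open>d * d\<close> into \<open>d\<close> letters of \<open>d\<close> bits. If \<open>X\<close> has \<open>L + 1\<close>
levels then the reversals already give \<open>2 ^ (L + 1)\<close> patterns, which is at least \<open>2 * k\<close>. If it has
exactly \<open>L\<close> levels, then some level carries two different branching nodes, with points \<open>x\<close>, \<open>y\<close> below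
the first and \<open>z\<close>, \<open>w\<close> below the second, and all reversals treat these nodes alike. Either the letters
of \<open>x\<close>, \<open>y\<close> and of \<open>z\<close>, \<open>w\<close> at that place differ, and ranking letters arbitrarily orders the two
pairs in opposite senses; or they agree, and reading this letter first pairs \<open>x\<close> with \<open>z\<close> and
\<open>y\<close> with \<open>w\<close>. Each alternative yields four further patterns (\<open>combined_orders_shatter\<close>), and both are
served by linearly many permutations in \<open>d\<close>: there are \<open>d * 2 ^ d\<close> letters to rank and \<open>d\<close> places
to read first.
\<close>

section \<open>Permutations and the patterns they induce\<close>

abbreviation patterns :: "'a rel set \<Rightarrow> 'a set \<Rightarrow> 'a rel set" where
  "patterns P X \<equiv> (\<lambda>r. induced_perm r X) ` P"

lemma induced_perm_iff [simp]: "(x, y) \<in> induced_perm r X \<longleftrightarrow> (x, y) \<in> r \<and> x \<in> X \<and> y \<in> X"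
  by (auto simp: induced_perm_def)

lemma perms_total:
  assumes "r \<in> perms X" "x \<in> X" "y \<in> X"
  shows "(x, y) \<in> r \<or> (y, x) \<in> r"
  using assms unfolding perms_def linear_order_on_def partial_order_on_def preorder_on_def
    total_on_def refl_on_def by (cases "x = y") auto

lemma perms_antisym:
  assumes "r \<in> perms X" "(x, y) \<in> r" "(y, x) \<in> r"
  shows "x = y"
  using assms unfolding perms_def linear_order_on_def partial_order_on_def
  by (auto dest: antisymD)

lemma perms_trans:
  assumes "r \<in> perms X" "(x, y) \<in> r" "(y, z) \<in> r"
  shows "(x, z) \<in> r"
  using assms unfolding perms_def linear_order_on_def partial_order_on_def preorder_on_def
  by (auto dest: transD)

lemma perms_refl: "r \<in> perms X \<Longrightarrow> x \<in> X \<Longrightarrow> (x, x) \<in> r"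
  using perms_total by fastforce

lemma perms_subset: "r \<in> perms X \<Longrightarrow> r \<subseteq> X \<times> X"
  unfolding perms_def linear_order_on_def partial_order_on_def preorder_on_def by auto

lemma finite_perms: "finite X \<Longrightarrow> finite (perms X)"
  by (rule finite_subset[of _ "Pow (X \<times> X)"]) (auto dest: perms_subset)

lemma finite_permutation_family: "P \<subseteq> perms {1..n::nat} \<Longrightarrow> finite P"
  using finite_perms finite_subset by blast

lemma shattering_family_card_ge:
  assumes "P \<subseteq> perms {1..n::nat}" "shatters t P X"
  shows "t \<le> card P"
  using assms finite_permutation_family card_image_le unfolding shatters_def by (metis le_trans)

lemma shatter_num_le:
  assumes "P \<subseteq> perms {1..n}" "\<And>X. X \<subseteq> {1..n} \<Longrightarrow> card X = k \<Longrightarrow> shatters t P X"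
  shows "shatter_num k n t \<le> card P"
  unfolding shatter_num_def by (rule Least_le) (use assms in blast)

lemma shatter_num_attained:
  assumes "P \<subseteq> perms {1..n}" "\<And>X. X \<subseteq> {1..n} \<Longrightarrow> card X = k \<Longrightarrow> shatters t P X"
  obtains Q where "Q \<subseteq> perms {1..n}" "card Q = shatter_num k n t"
    "\<And>X. X \<subseteq> {1..n} \<Longrightarrow> card X = k \<Longrightarrow> shatters t Q X"
proof -
  have "\<exists>Q. Q \<subseteq> perms {1..n} \<and> card Q = shatter_num k n t \<and>
      (\<forall>X. X \<subseteq> {1..n} \<and> card X = k \<longrightarrow> shatters t Q X)"
    unfolding shatter_num_def by (rule LeastI_ex) (use assms in blast)
  then show ?thesis using that by blast
qed

lemma shatters_mono_subset:
  assumes "finite P" "X \<subseteq> Y" "shatters t P X"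
  shows "shatters t P Y"
proof -
  have "patterns P X = (\<lambda>r. induced_perm r X) ` patterns P Y"
    using assms(2) by (auto simp: induced_perm_def image_image intro!: image_cong)
  then show ?thesis
    using assms(1,3) unfolding shatters_def by (metis card_image_le finite_imageI le_trans)
qed

text \<open>
The tie-break by the points themselves makes this a linear order for every key, so that keys need not
be injective on the whole ground set.
\<close>

definition key_order :: "('a::linorder \<Rightarrow> 'b::linorder) \<Rightarrow> 'a set \<Rightarrow> 'a rel" where
  "key_order f X = {(x, y) \<in> X \<times> X. f x < f y \<or> f x = f y \<and> x \<le> y}"

lemma key_order_in_perms: "key_order f X \<in> perms X"
  unfolding perms_def key_order_def linear_order_on_def partial_order_on_def preorder_on_def
  by (auto simp: refl_on_def trans_def antisym_def total_on_def)

lemma key_order_less: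
  assumes "x \<in> X" "y \<in> X" "f x < f y"
  shows "(x, y) \<in> key_order f X" "(y, x) \<notin> key_order f X"
  using assms by (auto simp: key_order_def)

lemma list_less_at_first_difference:
  fixes xs ys :: "'a::linorder list"
  assumes "i < length xs" "i < length ys" "\<And>j. j < i \<Longrightarrow> xs ! j = ys ! j" "xs ! i < ys ! i"
  shows "xs < ys"
proof -
  have "take i xs = take i ys"
    using assms by (intro nth_take_lemma) auto
  then show ?thesis
    using assms unfolding list_less_def lexord_take_index_conv by auto
qed

section \<open>At most two patterns\<close>

text \<open>
The usual order and its reverse induce different patterns on any two points.
\<close>

lemma shatter_num_small:
  assumes "t = 1 \<or> t = 2" "k \<ge> 2" "n \<ge> k"
  shows "shatter_num k n t = t"
proof -
  define up where "up = key_order (\<lambda>x. x) {1..n}"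
  define down where "down = key_order (\<lambda>x. - int x) {1..n}"
  define P where "P = (if t = 1 then {up} else {up, down})"
  have P: "P \<subseteq> perms {1..n}"
    unfolding P_def up_def down_def by (simp add: key_order_in_perms del: One_nat_def)
  have differ: "induced_perm up X \<noteq> induced_perm down X" if X: "X \<subseteq> {1..n}" "card X = k" for X
  proof -
    obtain x y where "x \<in> X" "y \<in> X" "x < y"
    proof -
      have "finite X" "\<not> card X \<le> Suc 0"
        using X assms(2) finite_subset by auto
      then show ?thesis
        using that card_le_Suc0_iff_eq[of X] by (metis linorder_neqE_nat)
    qed
    then have "(x, y) \<in> induced_perm up X" "(x, y) \<notin> induced_perm down X"
      using X by (auto simp: up_def down_def key_order_def)
    then show ?thesis by blast
  qed
  have sh: "shatters t P X" if X: "X \<subseteq> {1..n}" "card X = k" for X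
    using differ[OF X] assms(1) unfolding shatters_def P_def by auto
  have "shatter_num k n t \<le> card P"
    using shatter_num_le[OF P] sh by blast
  also have "card P \<le> t"
    using assms(1) by (auto simp: P_def card_insert_if)
  finally have upper: "shatter_num k n t \<le> t" .
  obtain Q where Q: "Q \<subseteq> perms {1..n}" "card Q = shatter_num k n t"
    "\<And>X. X \<subseteq> {1..n} \<Longrightarrow> card X = k \<Longrightarrow> shatters t Q X"
    using shatter_num_attained[OF P] sh by blast
  have "shatters t Q {1..k}"
    using Q(3) assms(3) by simp
  then have "t \<le> shatter_num k n t"
    using shattering_family_card_ge Q by metis
  with upper show ?thesis by simp
qed

section \<open>A logarithmic lower bound: peeling off points\<close>

lemma pigeonhole_class:
  assumes "finite Y" "finite Z" "f ` Y \<subseteq> Z" "card Y > card Z * s"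
  shows "\<exists>z\<in>Z. card {y \<in> Y. f y = z} > s"
proof (rule ccontr)
  assume "\<not> ?thesis"
  then have small: "card {y \<in> Y. f y = z} \<le> s" if "z \<in> Z" for z
    using that by (auto simp: not_less)
  have "Y = (\<Union>z\<in>Z. {y \<in> Y. f y = z})" using assms(3) by auto
  then have "card Y \<le> (\<Sum>z\<in>Z. card {y \<in> Y. f y = z})"
    by (metis assms(2) card_UN_le)
  also have "\<dots> \<le> (\<Sum>z\<in>Z. s)" using small by (rule sum_mono)
  finally show False using assms(4) by simp
qed

text \<open>
Choose any point \<open>x\<close> and classify the others by the set of permutations that put them above \<open>x\<close>. Within
one class each permutation has \<open>x\<close> entirely below or entirely above, so adding \<open>x\<close> to a subset of the
class at most doubles the number of patterns. There are \<open>2 ^ card P\<close> classes; the extra factor two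
in the bound on \<open>S\<close> absorbs the removal of \<open>x\<close>.
\<close>

lemma few_patterns_power_two:
  assumes P: "finite P" "P \<subseteq> perms N" and "finite S" "S \<subseteq> N"
    and "card S \<ge> 2 ^ ((card P + 1) * j)"
  shows "\<exists>Y \<subseteq> S. card Y = Suc j \<and> card (patterns P Y) \<le> 2 ^ j"
  using assms(3-)
proof (induction j arbitrary: S)
  case 0
  then obtain x where x: "x \<in> S" by fastforce
  have "patterns P {x} \<subseteq> {{(x, x)}}"
    using P 0 x by (force simp: induced_perm_def dest: perms_refl)
  then have "card (patterns P {x}) \<le> card {{(x, x)}}"
    by (intro card_mono) auto
  then show ?case using x by (intro exI[of _ "{x}"]) auto
next
  case (Suc j)
  define m where "m = card P"
  have "card S \<noteq> 0" using Suc.prems by (metis not_one_le_zero one_le_numeral one_le_power order_trans)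
  then obtain x where x: "x \<in> S" by fastforce
  define M where "M = (2::nat) ^ ((m + 1) * j)"
  have M: "M \<ge> 1" by (simp add: M_def)
  have "card (S - {x}) = card S - 1" using x Suc.prems by simp
  moreover have "card S \<ge> 2 * 2 ^ m * M"
    using Suc.prems(3) by (simp add: m_def M_def power_add mult_ac)
  moreover have "2 ^ m * (M - 1) + 2 ^ m = 2 ^ m * M" using M by (metis Nat.add_diff_assoc2 add_diff_cancel_right' mult.commute mult_Suc_right Suc_pred' less_eq_Suc_le One_nat_def add.commute)
  moreover have "(1::nat) \<le> 2 ^ m" by simp
  ultimately have "card (S - {x}) > 2 ^ m * (M - 1)" by linarith
  then have "card (S - {x}) > card (Pow P) * (M - 1)" using P by (simp add: card_Pow m_def)
  then have "\<exists>A\<in>Pow P. card {y \<in> S - {x}. {r \<in> P. (x, y) \<in> r} = A} > M - 1"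
    using Suc.prems P by (intro pigeonhole_class) auto
  then obtain A where A: "card {y \<in> S - {x}. {r \<in> P. (x, y) \<in> r} = A} > M - 1" by blast
  define S' where "S' = {y \<in> S - {x}. {r \<in> P. (x, y) \<in> r} = A}"
  have S': "finite S'" "S' \<subseteq> N" "card S' \<ge> 2 ^ ((card P + 1) * j)"
    using Suc.prems A by (auto simp: S'_def M_def m_def)
  obtain Y where Y: "Y \<subseteq> S'" "card Y = Suc j" "card (patterns P Y) \<le> 2 ^ j"
    using Suc.IH[OF S'] by blast
  have finY: "finite Y" and xY: "x \<notin> Y" using Y S' finite_subset by (auto simp: S'_def)
  have xN: "x \<in> N" "Y \<subseteq> N" using x Suc.prems Y S' by auto
  have side: "(x, y) \<in> r \<longleftrightarrow> r \<in> A" if "y \<in> Y" "r \<in> P" for y r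
    using that Y by (auto simp: S'_def)
  \<comment> \<open>Recovers the pattern on the enlarged set from the pattern on \<open>Y\<close> and the side of \<open>x\<close>.\<close>
  define ext where "ext = (\<lambda>(p, b). p \<union> {(x, x)} \<union> (if b then {x} \<times> Y else Y \<times> {x}))"
  have "induced_perm r (insert x Y) = ext (induced_perm r Y, r \<in> A)" if r: "r \<in> P" for r
  proof -
    have rp: "r \<in> perms N" using r P by blast
    have "(y, x) \<in> r \<longleftrightarrow> r \<notin> A" if "y \<in> Y" for y
      using side[OF that r] perms_total[OF rp, of x y] perms_antisym[OF rp, of x y] xN xY that by blast
    then show ?thesis
      using side r perms_refl[OF rp xN(1)] by (auto simp: ext_def induced_perm_def)
  qed
  then have "patterns P (insert x Y) \<subseteq> ext ` (patterns P Y \<times> UNIV)" by auto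
  then have "card (patterns P (insert x Y)) \<le> card (ext ` (patterns P Y \<times> (UNIV :: bool set)))"
    using P by (intro card_mono) auto
  also have "\<dots> \<le> card (patterns P Y \<times> (UNIV :: bool set))"
    using P by (intro card_image_le) auto
  also have "\<dots> \<le> 2 ^ Suc j" using Y by (simp add: card_cartesian_product)
  finally show ?case
    using Y x xY finY by (intro exI[of _ "insert x Y"]) (auto simp: S'_def)
qed

lemma card_less_if_shatters_many:
  fixes n :: nat
  assumes "P \<subseteq> perms {1..n}" "\<And>X. X \<subseteq> {1..n} \<Longrightarrow> card X = k \<Longrightarrow> shatters t P X"
    and "k \<ge> 1" "t > 2 ^ (k - 1)"
  shows "n < 2 ^ ((card P + 1) * (k - 1))"
proof (rule ccontr)
  assume "\<not> ?thesis"
  then have "\<exists>Y \<subseteq> {1..n}. card Y = Suc (k - 1) \<and> card (patterns P Y) \<le> 2 ^ (k - 1)"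
    using assms(1) finite_permutation_family[OF assms(1)]
    by (intro few_patterns_power_two[of P "{1..n}"]) auto
  then obtain Y where "Y \<subseteq> {1..n}" "card Y = Suc (k - 1)" "card (patterns P Y) \<le> 2 ^ (k - 1)"
    by blast
  then show False using assms(2)[of Y] assms(3,4) by (simp add: shatters_def)
qed

section \<open>A square root of logarithm lower bound: joining trees of equal type\<close>

definition separated :: "'a rel set \<Rightarrow> 'a set \<Rightarrow> 'a set \<Rightarrow> bool" where
  "separated P A B \<longleftrightarrow> (\<forall>r\<in>P. A \<times> B \<subseteq> r \<or> B \<times> A \<subseteq> r)"

lemma separated_sym: "separated P A B \<Longrightarrow> separated P B A"
  by (auto simp: separated_def)

lemma separated_mono: "separated P A B \<Longrightarrow> A' \<subseteq> A \<Longrightarrow> B' \<subseteq> B \<Longrightarrow> separated P A' B'"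
  unfolding separated_def by (meson Sigma_mono subset_trans)

lemma perms_min:
  assumes r: "r \<in> perms N" and "finite A" "A \<noteq> {}" "A \<subseteq> N"
  shows "\<exists>a\<in>A. \<forall>x\<in>A. (a, x) \<in> r"
  using assms(2-)
proof (induction A rule: finite_ne_induct)
  case (singleton x)
  then show ?case using perms_refl[OF r] by auto
next
  case (insert x A)
  then obtain a where a: "a \<in> A" "\<forall>y\<in>A. (a, y) \<in> r" by auto
  show ?case
  proof (cases "(a, x) \<in> r")
    case True
    then show ?thesis using a by auto
  next
    case False
    then have "(x, a) \<in> r" using perms_total[OF r, of a x] insert a by auto
    then have "\<forall>y\<in>insert x A. (x, y) \<in> r"
      using a perms_trans[OF r] perms_refl[OF r] insert by blast
    then show ?thesis by blast
  qed
qed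

lemma initial_segment:
  assumes r: "r \<in> perms N" and "finite A" "A \<subseteq> N" "s \<le> card A"
  shows "\<exists>A1 A2. A = A1 \<union> A2 \<and> A1 \<inter> A2 = {} \<and> card A1 = s \<and> A1 \<times> A2 \<subseteq> r"
  using assms(4)
proof (induction s)
  case 0
  show ?case by (intro exI[of _ "{}"] exI[of _ A]) auto
next
  case (Suc s)
  then obtain A1 A2 where A: "A = A1 \<union> A2" "A1 \<inter> A2 = {}" "card A1 = s" "A1 \<times> A2 \<subseteq> r"
    by auto
  have "A2 \<noteq> {}" using A Suc.prems by auto
  then obtain a where a: "a \<in> A2" "\<forall>x\<in>A2. (a, x) \<in> r"
    using perms_min[OF r, of A2] A assms(2,3) by auto
  have "finite A1" "a \<notin> A1" using A a assms(2) by auto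
  then show ?case
    using A a by (intro exI[of _ "insert a A1"] exI[of _ "A2 - {a}"]) auto
qed

text \<open>
Split \<open>A\<close> and \<open>B\<close> into a lower and an upper part. If neither lower part lies below the other upper part,
then some \<open>a2\<close> is below \<open>b1\<close> and some \<open>b2\<close> is below \<open>a1\<close>, and the chain
\<open>a1 \<le> a2 \<le> b1 \<le> b2\<close> contradicts the second relation.
\<close>

lemma separate_one:
  assumes r: "r \<in> perms N" and A: "finite A" "A \<subseteq> N" "2 * s \<le> card A"
    and B: "finite B" "B \<subseteq> N" "2 * s \<le> card B" and disj: "A \<inter> B = {}"
  shows "\<exists>A' B'. A' \<subseteq> A \<and> B' \<subseteq> B \<and> s \<le> card A' \<and> s \<le> card B' \<and> (A' \<times> B' \<subseteq> r \<or> B' \<times> A' \<subseteq> r)"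
proof -
  obtain A1 A2 where A12: "A = A1 \<union> A2" "A1 \<inter> A2 = {}" "card A1 = s" "A1 \<times> A2 \<subseteq> r"
    using initial_segment[OF r A(1,2), of s] A(3) by auto
  obtain B1 B2 where B12: "B = B1 \<union> B2" "B1 \<inter> B2 = {}" "card B1 = s" "B1 \<times> B2 \<subseteq> r"
    using initial_segment[OF r B(1,2), of s] B(3) by auto
  have cA: "s \<le> card A2" using A A12 card_Un_disjoint[of A1 A2] by auto
  have cB: "s \<le> card B2" using B B12 card_Un_disjoint[of B1 B2] by auto
  have "A1 \<times> B2 \<subseteq> r \<or> B1 \<times> A2 \<subseteq> r"
  proof (rule ccontr)
    assume "\<not> ?thesis"
    then obtain a1 b2 b1 a2 where el: "a1 \<in> A1" "b2 \<in> B2" "b1 \<in> B1" "a2 \<in> A2"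
      and no: "(a1, b2) \<notin> r" "(b1, a2) \<notin> r" by blast
    have "(a1, a2) \<in> r" "(b1, b2) \<in> r" using A12 B12 el by auto
    moreover have "(a2, b1) \<in> r"
    proof -
      have "a2 \<in> N" "b1 \<in> N" using el A(2) B(2) A12(1) B12(1) by blast+
      then show ?thesis using no(2) perms_total[OF r, of a2 b1] by blast
    qed
    ultimately show False using no(1) perms_trans[OF r] by blast
  qed
  then show ?thesis
  proof
    assume "A1 \<times> B2 \<subseteq> r"
    then show ?thesis using A12 B12 cB by (intro exI[of _ A1] exI[of _ B2]) auto
  next
    assume "B1 \<times> A2 \<subseteq> r"
    then show ?thesis using A12 B12 cA by (intro exI[of _ A2] exI[of _ B1]) auto
  qed
qed

lemma separate_all:
  assumes "finite P" "P \<subseteq> perms N" "finite A" "A \<subseteq> N" "finite B" "B \<subseteq> N" "A \<inter> B = {}"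
    and "2 ^ card P * s \<le> card A" "2 ^ card P * s \<le> card B"
  shows "\<exists>A' B'. A' \<subseteq> A \<and> B' \<subseteq> B \<and> s \<le> card A' \<and> s \<le> card B' \<and> separated P A' B'"
  using assms
proof (induction P arbitrary: A B rule: finite_induct)
  case empty
  then show ?case by (intro exI[of _ A] exI[of _ B]) (auto simp: separated_def)
next
  case (insert r P)
  have "\<exists>A' B'. A' \<subseteq> A \<and> B' \<subseteq> B \<and> 2 ^ card P * s \<le> card A' \<and> 2 ^ card P * s \<le> card B' \<and>
      (A' \<times> B' \<subseteq> r \<or> B' \<times> A' \<subseteq> r)"
    using insert by (intro separate_one[of r N]) (auto simp: mult_ac)
  then obtain A1 B1 where 1: "A1 \<subseteq> A" "B1 \<subseteq> B" "2 ^ card P * s \<le> card A1"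
    "2 ^ card P * s \<le> card B1" "A1 \<times> B1 \<subseteq> r \<or> B1 \<times> A1 \<subseteq> r" by blast
  have "\<exists>A' B'. A' \<subseteq> A1 \<and> B' \<subseteq> B1 \<and> s \<le> card A' \<and> s \<le> card B' \<and> separated P A' B'"
    using 1 insert.prems by (intro insert.IH) (auto intro: finite_subset)
  then obtain A2 B2 where 2: "A2 \<subseteq> A1" "B2 \<subseteq> B1" "s \<le> card A2" "s \<le> card B2" "separated P A2 B2"
    by blast
  have "separated (insert r P) A2 B2"
    using 1 2 unfolding separated_def by (metis Sigma_mono insert_iff subset_trans)
  then show ?case using 1 2 by (meson subset_trans)
qed

text \<open>
Split \<open>S\<close> into halves, thin them out until all permutations separate them, and recurse into both. One
round costs a factor two for halving and a factor two for each permutation.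
\<close>

lemma many_separated_sets:
  assumes P: "finite P" "P \<subseteq> perms N" and "finite S" "S \<subseteq> N"
    and "M \<ge> 1" "card S \<ge> 2 ^ ((card P + 1) * d) * M"
  shows "\<exists>\<A>. finite \<A> \<and> card \<A> = 2 ^ d \<and> (\<forall>A\<in>\<A>. A \<subseteq> S \<and> M \<le> card A) \<and>
    (\<forall>A\<in>\<A>. \<forall>B\<in>\<A>. A \<noteq> B \<longrightarrow> A \<inter> B = {} \<and> separated P A B)"
  using assms(3,4,6)
proof (induction d arbitrary: S)
  case 0
  then show ?case by (intro exI[of _ "{S}"]) auto
next
  case (Suc d)
  define h where "h = 2 ^ card P * (2 ^ ((card P + 1) * d) * M)"
  have "card S \<ge> 2 * h"
    using Suc.prems(3) by (simp add: h_def power_add mult_ac)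
  then obtain A where A: "A \<subseteq> S" "card A = h"
    by (metis obtain_subset_with_card_n le_add1 le_trans mult_2)
  define B where "B = S - A"
  have B: "B \<subseteq> S" "A \<inter> B = {}" "card B \<ge> h"
    using A Suc.prems \<open>card S \<ge> 2 * h\<close> by (auto simp: B_def card_Diff_subset finite_subset)
  have "\<exists>A' B'. A' \<subseteq> A \<and> B' \<subseteq> B \<and> 2 ^ ((card P + 1) * d) * M \<le> card A' \<and>
      2 ^ ((card P + 1) * d) * M \<le> card B' \<and> separated P A' B'"
    using P A B Suc.prems by (intro separate_all[of P N]) (auto simp: h_def intro: finite_subset)
  then obtain A' B' where AB: "A' \<subseteq> A" "B' \<subseteq> B" "2 ^ ((card P + 1) * d) * M \<le> card A'"
    "2 ^ ((card P + 1) * d) * M \<le> card B'" "separated P A' B'" by blast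
  have fin: "finite A'" "finite B'" using AB(1,2) A(1) B(1) Suc.prems(1) by (meson finite_subset)+
  have sub: "A' \<subseteq> N" "B' \<subseteq> N" using AB(1,2) A(1) B(1) Suc.prems(2) by blast+
  obtain \<A> where a: "finite \<A>" "card \<A> = 2 ^ d" "\<forall>X\<in>\<A>. X \<subseteq> A' \<and> M \<le> card X"
    "\<forall>X\<in>\<A>. \<forall>Y\<in>\<A>. X \<noteq> Y \<longrightarrow> X \<inter> Y = {} \<and> separated P X Y"
    using Suc.IH[OF fin(1) sub(1) AB(3)] by (elim exE conjE) (rule that)
  obtain \<B> where b: "finite \<B>" "card \<B> = 2 ^ d" "\<forall>X\<in>\<B>. X \<subseteq> B' \<and> M \<le> card X"
    "\<forall>X\<in>\<B>. \<forall>Y\<in>\<B>. X \<noteq> Y \<longrightarrow> X \<inter> Y = {} \<and> separated P X Y"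
    using Suc.IH[OF fin(2) sub(2) AB(4)] by (elim exE conjE) (rule that)
  have cross: "X \<inter> Y = {} \<and> separated P X Y" if "X \<in> \<A>" "Y \<in> \<B>" for X Y
  proof -
    have "X \<subseteq> A'" "Y \<subseteq> B'" using a b that by auto
    then show ?thesis using AB B separated_mono by blast
  qed
  have "\<A> \<inter> \<B> = {}"
  proof (rule ccontr)
    assume "\<A> \<inter> \<B> \<noteq> {}"
    then obtain X where "X \<in> \<A>" "X \<in> \<B>" by blast
    then have "X = {}" "M \<le> card X" using cross a by blast+
    then show False using \<open>M \<ge> 1\<close> by simp
  qed
  then have "card (\<A> \<union> \<B>) = 2 ^ Suc d" using a b by (simp add: card_Un_disjoint)
  moreover have "X \<inter> Y = {} \<and> separated P X Y" if "X \<in> \<A> \<union> \<B>" "Y \<in> \<A> \<union> \<B>" "X \<noteq> Y" for X Y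
    using that(1,2)
  proof (elim UnE)
    assume "X \<in> \<A>" "Y \<in> \<A>"
    then show ?thesis using a(4) that(3) by simp
  next
    assume "X \<in> \<B>" "Y \<in> \<B>"
    then show ?thesis using b(4) that(3) by simp
  next
    assume "X \<in> \<A>" "Y \<in> \<B>"
    then show ?thesis by (rule cross)
  next
    assume "X \<in> \<B>" "Y \<in> \<A>"
    then show ?thesis using cross[of Y X] separated_sym[of P Y X] by (simp add: Int_commute)
  qed
  moreover have "X \<subseteq> S \<and> M \<le> card X" if "X \<in> \<A> \<union> \<B>" for X
    using that
  proof
    assume "X \<in> \<A>"
    then show ?thesis using a(3) AB(1) A(1) by (meson subset_trans)
  next
    assume "X \<in> \<B>"
    then show ?thesis using b(3) AB(2) B(1) by (meson subset_trans)
  qed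
  ultimately show ?case using a(1) b(1) by (intro exI[of _ "\<A> \<union> \<B>"] conjI ballI impI) auto
qed

text \<open>
The leaf sets of complete binary trees in which all nodes of a level look alike: the entry of the list
for a level is the set of permutations that put the left subtree of every node of that level below
its right subtree.
\<close>

inductive level_tree :: "'a rel set \<Rightarrow> 'a rel set list \<Rightarrow> 'a set \<Rightarrow> bool" for P where
  leaf: "level_tree P [] {x}"
| node: "level_tree P \<tau> A \<Longrightarrow> level_tree P \<tau> B \<Longrightarrow> A \<inter> B = {} \<Longrightarrow>
    \<forall>r\<in>P. if r \<in> \<sigma> then A \<times> B \<subseteq> r else B \<times> A \<subseteq> r \<Longrightarrow> level_tree P (\<sigma> # \<tau>) (A \<union> B)"

lemma level_tree_card: "level_tree P \<tau> Y \<Longrightarrow> finite Y \<and> card Y = 2 ^ length \<tau>"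
  by (induction rule: level_tree.induct) (auto simp: card_Un_disjoint)

lemma level_tree_pattern_determined:
  assumes "level_tree P \<tau> Y" and "P \<subseteq> perms N" "r \<in> P" "r' \<in> P"
    and "map (\<lambda>\<sigma>. r \<in> \<sigma>) \<tau> = map (\<lambda>\<sigma>. r' \<in> \<sigma>) \<tau>" "Y \<subseteq> N"
  shows "induced_perm r Y = induced_perm r' Y"
  using assms(1,5,6)
proof (induction rule: level_tree.induct)
  case (leaf x)
  then show ?case using perms_refl assms(2-4) by (force simp: induced_perm_def)
next
  case (node \<tau> A B \<sigma>)
  have p: "r \<in> perms N" "r' \<in> perms N" using assms by auto
  have cross: "(x, y) \<in> q \<longleftrightarrow> q \<in> \<sigma>" "(y, x) \<in> q \<longleftrightarrow> q \<notin> \<sigma>"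
    if "x \<in> A" "y \<in> B" "q \<in> P" for x y q
  proof -
    have "q \<in> perms N" "x \<noteq> y" using that assms node by auto
    then show "(x, y) \<in> q \<longleftrightarrow> q \<in> \<sigma>" "(y, x) \<in> q \<longleftrightarrow> q \<notin> \<sigma>"
      using node(4) that perms_antisym[of q N x y] by (auto split: if_splits)
  qed
  have same: "r \<in> \<sigma> \<longleftrightarrow> r' \<in> \<sigma>" using node.prems by simp
  have "induced_perm r A = induced_perm r' A" "induced_perm r B = induced_perm r' B"
    using node by auto
  then have "(x, y) \<in> r \<longleftrightarrow> (x, y) \<in> r'" if "x \<in> A \<and> y \<in> A \<or> x \<in> B \<and> y \<in> B" for x y
    using that by (metis induced_perm_iff)
  then have "(x, y) \<in> r \<longleftrightarrow> (x, y) \<in> r'" if "x \<in> A \<union> B" "y \<in> A \<union> B" for x y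
    using that cross same assms(3,4) by blast
  then show ?case by (auto simp: induced_perm_def)
qed

text \<open>
A pattern on the leaves is determined by one bit for each level.
\<close>

lemma level_tree_few_patterns:
  assumes "level_tree P \<tau> Y" "P \<subseteq> perms N" "finite P" "Y \<subseteq> N"
  shows "card (patterns P Y) \<le> 2 ^ length \<tau>"
proof -
  define vec where "vec = (\<lambda>r. map (\<lambda>\<sigma>. r \<in> \<sigma>) \<tau>)"
  define rep where "rep = (\<lambda>v. SOME s. s \<in> P \<and> vec s = v)"
  define g where "g = (\<lambda>v. induced_perm (rep v) Y)"
  have g: "induced_perm r Y = g (vec r)" if r: "r \<in> P" for r
  proof -
    have rep: "rep (vec r) \<in> P \<and> vec (rep (vec r)) = vec r"
      unfolding rep_def by (rule someI[of _ r]) (simp add: r)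
    have "map (\<lambda>\<sigma>. r \<in> \<sigma>) \<tau> = map (\<lambda>\<sigma>. rep (vec r) \<in> \<sigma>) \<tau>"
      using rep unfolding vec_def by simp
    then show ?thesis
      unfolding g_def using assms(1,2,4) r rep by (intro level_tree_pattern_determined) auto
  qed
  define V where "V = {bs::bool list. set bs \<subseteq> UNIV \<and> length bs = length \<tau>}"
  have V: "finite V" "card V = 2 ^ length \<tau>"
    unfolding V_def using finite_lists_length_eq[of "UNIV::bool set"] card_lists_length_eq[of "UNIV::bool set"]
    by auto
  have "patterns P Y \<subseteq> g ` V" using g by (auto simp: V_def vec_def)
  then show ?thesis using V by (metis card_image_le card_mono finite_imageI le_trans)
qed

text \<open>
Trees of depth \<open>j\<close> have at most \<open>2 ^ (card P * j)\<close> types. Among \<open>2 ^ (card P * j + 1)\<close> separated sets,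
each large enough to contain such a tree, two contain trees of one type, and these become the two
subtrees of a tree of depth \<open>j + 1\<close>. The exponent in the size bound is a convenient majorant of the
sum over \<open>j\<close> of the costs \<open>(card P + 1) * (card P * j + 1)\<close>.
\<close>

lemma level_tree_exists:
  assumes P: "finite P" "P \<subseteq> perms N" and "finite S" "S \<subseteq> N"
    and "card S \<ge> 2 ^ ((card P + 1)\<^sup>2 * j\<^sup>2)"
  shows "\<exists>Y\<subseteq>S. \<exists>\<tau>. level_tree P \<tau> Y \<and> length \<tau> = j \<and> set \<tau> \<subseteq> Pow P"
  using assms(3-)
proof (induction j arbitrary: S)
  case 0
  then obtain x where "x \<in> S" by fastforce
  then show ?case by (intro exI[of _ "{x}"] conjI exI[of _ "[]"]) (auto intro: leaf)
next
  case (Suc j)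
  define m where "m = card P"
  define M where "M = (2::nat) ^ ((m + 1)\<^sup>2 * j\<^sup>2)"
  have "(m + 1) * (m * j + 1) + (m + 1)\<^sup>2 * j\<^sup>2 \<le> (m + 1)\<^sup>2 * (Suc j)\<^sup>2"
    by (simp add: power2_eq_square algebra_simps)
  then have "(2::nat) ^ ((m + 1) * (m * j + 1) + (m + 1)\<^sup>2 * j\<^sup>2) \<le> 2 ^ ((m + 1)\<^sup>2 * (Suc j)\<^sup>2)"
    by (rule power_increasing) simp
  then have "2 ^ ((m + 1) * (m * j + 1)) * M \<le> 2 ^ ((m + 1)\<^sup>2 * (Suc j)\<^sup>2)"
    unfolding M_def power_add .
  then have big: "card S \<ge> 2 ^ ((card P + 1) * (m * j + 1)) * M"
    using Suc.prems by (simp add: m_def)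
  have M1: "M \<ge> 1" by (simp add: M_def)
  obtain \<A> where a: "finite \<A>" "card \<A> = 2 ^ (m * j + 1)" "\<forall>A\<in>\<A>. A \<subseteq> S \<and> M \<le> card A"
    "\<forall>A\<in>\<A>. \<forall>B\<in>\<A>. A \<noteq> B \<longrightarrow> A \<inter> B = {} \<and> separated P A B"
    using many_separated_sets[OF P Suc.prems(1,2) M1 big] by (elim exE conjE) (rule that)
  have "\<forall>A\<in>\<A>. \<exists>Y\<subseteq>A. \<exists>\<tau>. level_tree P \<tau> Y \<and> length \<tau> = j \<and> set \<tau> \<subseteq> Pow P"
    using a(3) Suc.prems by (intro ballI Suc.IH) (auto simp: M_def m_def intro: finite_subset)
  then obtain Y \<tau> where Y: "\<And>A. A \<in> \<A> \<Longrightarrow> Y A \<subseteq> A" "\<And>A. A \<in> \<A> \<Longrightarrow> level_tree P (\<tau> A) (Y A)"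
    "\<And>A. A \<in> \<A> \<Longrightarrow> length (\<tau> A) = j" "\<And>A. A \<in> \<A> \<Longrightarrow> set (\<tau> A) \<subseteq> Pow P"
    by metis
  have "\<not> inj_on \<tau> \<A>"
  proof
    assume "inj_on \<tau> \<A>"
    moreover have "\<tau> ` \<A> \<subseteq> {ts. set ts \<subseteq> Pow P \<and> length ts = j}"
      using Y(3,4) by (simp add: image_subset_iff)
    ultimately have "card \<A> \<le> card {ts. set ts \<subseteq> Pow P \<and> length ts = j}"
      using P by (intro card_inj_on_le) (auto simp: finite_lists_length_eq)
    also have "\<dots> = 2 ^ (m * j)"
      using P by (simp add: card_lists_length_eq card_Pow m_def power_mult)
    finally show False using a(2) by simp
  qed
  then obtain A B where AB: "A \<in> \<A>" "B \<in> \<A>" "A \<noteq> B" "\<tau> A = \<tau> B" by (auto simp: inj_on_def)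
  define \<sigma> where "\<sigma> = {r \<in> P. Y A \<times> Y B \<subseteq> r}"
  have sub: "Y A \<subseteq> A" "Y B \<subseteq> B" using Y(1) AB(1,2) by auto
  have AB': "A \<inter> B = {}" "separated P A B" using a(4) AB(1-3) by auto
  have sep: "separated P (Y A) (Y B)" by (rule separated_mono[OF AB'(2) sub])
  have "level_tree P (\<sigma> # \<tau> A) (Y A \<union> Y B)"
  proof (rule node)
    show "level_tree P (\<tau> A) (Y A)" "level_tree P (\<tau> A) (Y B)"
      using Y(2)[OF AB(1)] Y(2)[OF AB(2)] AB(4) by auto
    show "Y A \<inter> Y B = {}" using AB'(1) sub by blast
    show "\<forall>r\<in>P. if r \<in> \<sigma> then Y A \<times> Y B \<subseteq> r else Y B \<times> Y A \<subseteq> r"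
      using sep unfolding separated_def \<sigma>_def by auto
  qed
  moreover have "Y A \<union> Y B \<subseteq> S" using sub a(3) AB(1,2) by blast
  moreover have "length (\<sigma> # \<tau> A) = Suc j" using Y(3)[OF AB(1)] by simp
  moreover have "set (\<sigma> # \<tau> A) \<subseteq> Pow P" using Y(4)[OF AB(1)] by (auto simp: \<sigma>_def)
  ultimately show ?case by blast
qed

lemma card_less_if_shatters_above_tree:
  fixes n :: nat
  assumes P: "P \<subseteq> perms {1..n}" "\<And>X. X \<subseteq> {1..n} \<Longrightarrow> card X = k \<Longrightarrow> shatters t P X"
    and "k \<le> 2 ^ L" "t > 2 ^ L"
  shows "n < 2 ^ ((card P + 1)\<^sup>2 * L\<^sup>2)"
proof (rule ccontr)
  assume "\<not> ?thesis"
  then have "\<exists>Y\<subseteq>{1..n}. \<exists>\<tau>. level_tree P \<tau> Y \<and> length \<tau> = L \<and> set \<tau> \<subseteq> Pow P"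
    using P(1) finite_permutation_family[OF P(1)]
    by (intro level_tree_exists[of P "{1..n}"]) auto
  then obtain Y \<tau> where Y: "Y \<subseteq> {1..n}" "level_tree P \<tau> Y" "length \<tau> = L" by blast
  obtain X where X: "X \<subseteq> Y" "card X = k"
    using level_tree_card[OF Y(2)] Y(3) assms(3) obtain_subset_with_card_n by metis
  have fP: "finite P" using P finite_permutation_family by blast
  have "shatters t P Y"
    using shatters_mono_subset[OF fP X(1)] P X Y by blast
  then show False
    using level_tree_few_patterns[OF Y(2) P(1) fP Y(1)] assms(4) unfolding shatters_def Y(3) by linarith
qed

section \<open>A doubly logarithmic lower bound: common monotone subsets\<close>

definition increasing_on :: "nat rel \<Rightarrow> nat set \<Rightarrow> bool" where
  "increasing_on r Y \<longleftrightarrow> (\<forall>x\<in>Y. \<forall>y\<in>Y. x < y \<longrightarrow> (x, y) \<in> r)"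

lemma increasing_on_subset: "increasing_on r Y \<Longrightarrow> Z \<subseteq> Y \<Longrightarrow> increasing_on r Z"
  unfolding increasing_on_def by blast

text \<open>
The label of a point is the largest size of an increasing set that ends in it.
\<close>

lemma increasing_length_label:
  assumes "trans r" "finite X"
  shows "\<exists>l. (\<forall>x\<in>X. 1 \<le> l x \<and> (\<exists>Y\<subseteq>X. card Y = l x \<and> increasing_on r Y)) \<and>
    (\<forall>x\<in>X. \<forall>y\<in>X. x < y \<and> (x, y) \<in> r \<longrightarrow> l x < l y)"
proof -
  define ending where "ending = (\<lambda>x. {Y. Y \<subseteq> X \<and> x \<in> Y \<and> (\<forall>y\<in>Y. y \<le> x) \<and> increasing_on r Y})"
  define l where "l = (\<lambda>x. Max (card ` ending x))"
  have fin: "finite (ending x)" for x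
    by (rule finite_subset[of _ "Pow X"]) (auto simp: ending_def assms(2))
  have sing: "{x} \<in> ending x" if "x \<in> X" for x
    using that by (auto simp: ending_def increasing_on_def)
  have att: "\<exists>Y\<in>ending x. card Y = l x" if "x \<in> X" for x
  proof -
    have "l x \<in> card ` ending x"
      unfolding l_def using fin sing[OF that] by (intro Max_in) auto
    then show ?thesis by auto
  qed
  have le: "card Y \<le> l x" if "Y \<in> ending x" for x Y
    unfolding l_def using fin that by (intro Max_ge) auto
  have "1 \<le> l x" if "x \<in> X" for x using le[OF sing[OF that]] by simp
  moreover have "\<exists>Y\<subseteq>X. card Y = l x \<and> increasing_on r Y" if "x \<in> X" for x
    using att[OF that] by (auto simp: ending_def)
  moreover have "l x < l y" if xy: "x \<in> X" "y \<in> X" "x < y" "(x, y) \<in> r" for x y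
  proof -
    obtain Y where Y: "Y \<in> ending x" "card Y = l x" using att[OF xy(1)] by blast
    have "(z, y) \<in> r" if "z \<in> Y" for z
    proof (cases "z = x")
      case False
      then have "(z, x) \<in> r" using Y(1) that by (auto simp: ending_def increasing_on_def)
      then show ?thesis using xy(4) assms(1) by (meson transD)
    qed (use xy(4) in simp)
    moreover have "\<And>z. z \<in> Y \<Longrightarrow> z < y" using Y(1) xy(3) by (force simp: ending_def)
    ultimately have "insert y Y \<in> ending y" "y \<notin> Y"
      using Y(1) xy by (fastforce simp: ending_def increasing_on_def)+
    moreover have "finite Y" using Y(1) assms(2) finite_subset by (auto simp: ending_def)
    ultimately show ?thesis using le[of "insert y Y" y] Y(2) by simp
  qed
  ultimately show ?thesis by blast
qed

text \<open>
Label each point with the lengths of the longest increasing and decreasing sets ending in it. Of two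
points, the later one has a larger label in one of the coordinates, so labels are distinct; if all
lengths were at most \<open>s\<close> there would be only \<open>s * s\<close> labels.
\<close>

lemma Erdos_Szekeres:
  assumes r: "r \<in> perms N" and X: "finite X" "X \<subseteq> N" "card X > s * s"
  shows "\<exists>Y\<subseteq>X. card Y > s \<and> (increasing_on r Y \<or> increasing_on (r\<inverse>) Y)"
proof (rule ccontr)
  assume none: "\<not> ?thesis"
  have "trans r" using perms_trans[OF r] by (rule transI)
  obtain l where l: "\<forall>x\<in>X. 1 \<le> l x \<and> (\<exists>Y\<subseteq>X. card Y = l x \<and> increasing_on r Y)"
    "\<forall>x\<in>X. \<forall>y\<in>X. x < y \<and> (x, y) \<in> r \<longrightarrow> l x < l y"
    using increasing_length_label[OF \<open>trans r\<close> X(1)] by auto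
  have "trans (r\<inverse>)" using \<open>trans r\<close> by simp
  obtain l' where l': "\<forall>x\<in>X. 1 \<le> l' x \<and> (\<exists>Y\<subseteq>X. card Y = l' x \<and> increasing_on (r\<inverse>) Y)"
    "\<forall>x\<in>X. \<forall>y\<in>X. x < y \<and> (x, y) \<in> r\<inverse> \<longrightarrow> l' x < l' y"
    using increasing_length_label[OF \<open>trans (r\<inverse>)\<close> X(1)] by auto
  have bound: "card Y \<le> s" if "Y \<subseteq> X" "increasing_on r Y \<or> increasing_on (r\<inverse>) Y" for Y
    using none that by (meson not_le)
  have "l x \<in> {1..s} \<and> l' x \<in> {1..s}" if x: "x \<in> X" for x
  proof -
    obtain Y where "Y \<subseteq> X" "card Y = l x" "increasing_on r Y" using l(1) x by blast
    moreover obtain Z where "Z \<subseteq> X" "card Z = l' x" "increasing_on (r\<inverse>) Z" using l'(1) x by blast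
    moreover have "1 \<le> l x" "1 \<le> l' x" using l(1) l'(1) x by auto
    ultimately show ?thesis using bound[of Y] bound[of Z] by auto
  qed
  then have "(\<lambda>x. (l x, l' x)) ` X \<subseteq> {1..s} \<times> {1..s}" by auto
  moreover have "inj_on (\<lambda>x. (l x, l' x)) X"
  proof (rule linorder_inj_onI')
    fix x y assume xy: "x \<in> X" "y \<in> X" "x < y"
    then show "(l x, l' x) \<noteq> (l y, l' y)"
      using l(2) l'(2) perms_total[OF r, of x y] X(2) by (metis converse_iff fst_conv less_irrefl snd_conv subsetD)
  qed
  ultimately have "card X \<le> card ({1..s} \<times> {1..s})" by (intro card_inj_on_le) auto
  then show False using X(3) by simp
qed

lemma common_monotone_subset:
  assumes "finite P" "P \<subseteq> perms N" "finite X" "X \<subseteq> N" "card X > s ^ 2 ^ card P"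
  shows "\<exists>Y\<subseteq>X. card Y > s \<and> (\<forall>r\<in>P. increasing_on r Y \<or> increasing_on (r\<inverse>) Y)"
  using assms
proof (induction P arbitrary: X rule: finite_induct)
  case empty
  then show ?case by (intro exI[of _ X]) auto
next
  case (insert r P)
  have "s ^ 2 ^ card P * s ^ 2 ^ card P < card X"
    using insert by (simp add: mult_2 flip: power_add)
  then obtain Y where Y: "Y \<subseteq> X" "card Y > s ^ 2 ^ card P" "increasing_on r Y \<or> increasing_on (r\<inverse>) Y"
    using Erdos_Szekeres[of r N X "s ^ 2 ^ card P"] insert.prems by auto
  have "\<exists>Z\<subseteq>Y. card Z > s \<and> (\<forall>r\<in>P. increasing_on r Z \<or> increasing_on (r\<inverse>) Z)"
    using Y insert.prems by (intro insert.IH) (auto intro: finite_subset)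
  then obtain Z where Z: "Z \<subseteq> Y" "card Z > s" "\<forall>r\<in>P. increasing_on r Z \<or> increasing_on (r\<inverse>) Z"
    by blast
  have "increasing_on r Z \<or> increasing_on (r\<inverse>) Z" using Y(3) Z(1) increasing_on_subset by blast
  then show ?case using Y(1) Z by (intro exI[of _ Z]) auto
qed

lemma card_le_if_shatters_three:
  fixes n :: nat
  assumes P: "P \<subseteq> perms {1..n}" "\<And>X. X \<subseteq> {1..n} \<Longrightarrow> card X = k \<Longrightarrow> shatters t P X"
    and "k \<ge> 1" "t \<ge> 3"
  shows "n \<le> (k - 1) ^ 2 ^ card P"
proof (rule ccontr)
  assume "\<not> ?thesis"
  then have "\<exists>Y\<subseteq>{1..n}. card Y > k - 1 \<and> (\<forall>r\<in>P. increasing_on r Y \<or> increasing_on (r\<inverse>) Y)"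
    using P(1) finite_permutation_family[OF P(1)]
    by (intro common_monotone_subset[of P "{1..n}"]) auto
  then obtain Y where Y: "Y \<subseteq> {1..n}" "card Y \<ge> k" "\<forall>r\<in>P. increasing_on r Y \<or> increasing_on (r\<inverse>) Y"
    by fastforce
  obtain X where X: "X \<subseteq> Y" "card X = k" using Y(2) obtain_subset_with_card_n by metis
  define up where "up = {(x, y) \<in> X \<times> X. x \<le> y}"
  have "induced_perm r X \<in> {up, up\<inverse>}" if r: "r \<in> P" for r
  proof -
    have rp: "r \<in> perms {1..n}" using P r by auto
    have refl: "(x, x) \<in> r" if "x \<in> X" for x using perms_refl[OF rp] that X Y by blast
    have anti: "x = y" if "(x, y) \<in> r" "(y, x) \<in> r" for x y using perms_antisym[OF rp] that by blast
    have "increasing_on r X \<or> increasing_on (r\<inverse>) X" using Y r X increasing_on_subset by blast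
    then show ?thesis
    proof
      assume i: "increasing_on r X"
      have "induced_perm r X = up"
      proof (intro set_eqI, clarify)
        fix x y show "(x, y) \<in> induced_perm r X \<longleftrightarrow> (x, y) \<in> up"
          using i refl[of x] anti[of x y] unfolding up_def increasing_on_def
          by (cases x y rule: linorder_cases) auto
      qed
      then show ?thesis by simp
    next
      assume i: "increasing_on (r\<inverse>) X"
      have "induced_perm r X = up\<inverse>"
      proof (intro set_eqI, clarify)
        fix x y show "(x, y) \<in> induced_perm r X \<longleftrightarrow> (x, y) \<in> up\<inverse>"
          using i refl[of x] anti[of x y] unfolding up_def increasing_on_def
          by (cases x y rule: linorder_cases) auto
      qed
      then show ?thesis by simp
    qed
  qed
  then have "patterns P X \<subseteq> {up, up\<inverse>}" by blast
  then have "card (patterns P X) \<le> card {up, up\<inverse>}" by (intro card_mono) auto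
  also have "\<dots> \<le> 2" by (simp add: card_insert_if)
  finally show False using P(2)[of X] X Y assms(4) unfolding shatters_def by auto
qed
section \<open>Small families of functions with prescribed values\<close>

text \<open>
By double counting, some \<open>w\<close> hits at least a fraction \<open>1 / q\<close> of the indices that are still unhit.
Adding it leaves at most a fraction \<open>1 - 1 / q\<close> of them.
\<close>

lemma greedy_hitting_set:
  fixes R :: "'w \<Rightarrow> 'i \<Rightarrow> bool" and q :: real
  assumes "finite \<Omega>" "\<Omega> \<noteq> {}" "finite I" "q \<ge> 1"
    and dense: "\<And>i. i \<in> I \<Longrightarrow> card \<Omega> \<le> q * card {w \<in> \<Omega>. R w i}"
  shows "\<exists>H \<subseteq> \<Omega>. card H \<le> m \<and> card {i \<in> I. \<forall>w\<in>H. \<not> R w i} \<le> card I * (1 - 1 / q) ^ m"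
proof (induction m)
  case 0
  show ?case by (intro exI[of _ "{}"]) auto
next
  case (Suc m)
  then obtain H where H: "H \<subseteq> \<Omega>" "card H \<le> m"
    "card {i \<in> I. \<forall>w\<in>H. \<not> R w i} \<le> card I * (1 - 1 / q) ^ m" by blast
  define J where "J = {i \<in> I. \<forall>w\<in>H. \<not> R w i}"
  have fJ: "finite J" "J \<subseteq> I" using assms by (auto simp: J_def)
  have "\<exists>w\<in>\<Omega>. card J \<le> q * card {i \<in> J. R w i}"
  proof (rule ccontr)
    assume neg: "\<not> ?thesis"
    have "card \<Omega> * real (card J) = (\<Sum>i\<in>J. real (card \<Omega>))" by simp
    also have "\<dots> \<le> (\<Sum>i\<in>J. q * card {w \<in> \<Omega>. R w i})"
      using dense fJ by (intro sum_mono) auto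
    also have "\<dots> = q * (\<Sum>i\<in>J. \<Sum>w\<in>\<Omega>. if R w i then 1 else 0)"
      using assms(1) by (simp add: sum_distrib_left sum.If_cases Int_def)
    also have "\<dots> = q * (\<Sum>w\<in>\<Omega>. \<Sum>i\<in>J. if R w i then 1 else 0)"
      by (subst sum.swap) simp
    also have "\<dots> = (\<Sum>w\<in>\<Omega>. q * card {i \<in> J. R w i})"
      using fJ by (simp add: sum_distrib_left sum.If_cases Int_def)
    also have "\<dots> < (\<Sum>w\<in>\<Omega>. real (card J))"
      using neg assms by (intro sum_strict_mono) (auto simp: not_le)
    finally show False by simp
  qed
  then obtain w where w: "w \<in> \<Omega>" "card J \<le> q * card {i \<in> J. R w i}" by blast
  have "{i \<in> I. \<forall>w\<in>insert w H. \<not> R w i} = J - {i \<in> J. R w i}"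
    by (auto simp: J_def)
  then have "real (card {i \<in> I. \<forall>w\<in>insert w H. \<not> R w i}) = card J - real (card {i \<in> J. R w i})"
    using fJ by (simp add: card_Diff_subset card_mono of_nat_diff)
  also have "\<dots> \<le> card J * (1 - 1 / q)"
    using w(2) assms(4) by (simp add: field_simps)
  also have "\<dots> \<le> card I * (1 - 1 / q) ^ m * (1 - 1 / q)"
    using H(3) assms(4) unfolding J_def by (intro mult_right_mono) auto
  finally have "card {i \<in> I. \<forall>w\<in>insert w H. \<not> R w i} \<le> card I * (1 - 1 / q) ^ Suc m"
    by (simp add: mult_ac)
  moreover have "insert w H \<subseteq> \<Omega>" "card (insert w H) \<le> Suc m"
    using H w assms(1) by (auto simp: card_insert_if finite_subset)
  ultimately show ?case by blast
qed

lemma small_hitting_set: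
  fixes R :: "'w \<Rightarrow> 'i \<Rightarrow> bool" and q :: real
  assumes "finite \<Omega>" "\<Omega> \<noteq> {}" "finite I" "I \<noteq> {}" "q \<ge> 1"
    and dense: "\<And>i. i \<in> I \<Longrightarrow> card \<Omega> \<le> q * card {w \<in> \<Omega>. R w i}"
  shows "\<exists>H \<subseteq> \<Omega>. card H \<le> q * ln (card I) + 1 \<and> (\<forall>i\<in>I. \<exists>w\<in>H. R w i)"
proof -
  define m where "m = Suc (nat \<lfloor>q * ln (card I)\<rfloor>)"
  have I1: "card I \<ge> 1" using assms by (simp add: Suc_leI card_gt_0_iff)
  then have ln0: "ln (real (card I)) \<ge> 0" by simp
  have nn: "q * ln (card I) \<ge> 0" using assms(5) ln0 by simp
  have m: "real m > q * ln (card I)" "real m \<le> q * ln (card I) + 1"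
    using nn unfolding m_def by linarith+
  have "\<exists>H \<subseteq> \<Omega>. card H \<le> m \<and> card {i \<in> I. \<forall>w\<in>H. \<not> R w i} \<le> card I * (1 - 1 / q) ^ m"
    using assms(1,2,3,5) dense by (rule greedy_hitting_set)
  then obtain H where H: "H \<subseteq> \<Omega>" "card H \<le> m"
    "card {i \<in> I. \<forall>w\<in>H. \<not> R w i} \<le> card I * (1 - 1 / q) ^ m"
    by blast
  have "(1 - 1 / q) ^ m \<le> exp (- (1 / q)) ^ m"
  proof (rule power_mono)
    show "1 - 1 / q \<le> exp (- (1 / q))"
      using exp_ge_add_one_self[of "- (1 / q)"] by linarith
    show "0 \<le> 1 - 1 / q" using assms(5) by simp
  qed
  also have "\<dots> = exp (- (m / q))"
    by (simp flip: exp_of_nat_mult)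
  also have "\<dots> < exp (- ln (card I))"
    using m(1) assms(5) by (simp add: field_simps)
  also have "\<dots> = 1 / card I"
    using I1 by (simp add: exp_minus field_simps)
  finally have "card I * (1 - 1 / q) ^ m < 1"
    using I1 by (simp add: field_simps)
  with H(3) have "card {i \<in> I. \<forall>w\<in>H. \<not> R w i} = 0" by linarith
  then have "\<forall>i\<in>I. \<exists>w\<in>H. R w i" using assms(3) by auto
  moreover have "real (card H) \<le> q * ln (card I) + 1" using H(2) m(2) by linarith
  ultimately show ?thesis using H(1) by blast
qed

text \<open>
This is the property of \<open>K\<close>-wise independence that counts here: any values below \<open>v\<close> prescribed on at
most \<open>K\<close> arguments are taken by some member of the family.
\<close>

definition independent :: "nat \<Rightarrow> 'u set \<Rightarrow> nat \<Rightarrow> ('u \<Rightarrow> nat) set \<Rightarrow> bool" where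
  "independent K U v F \<longleftrightarrow>
    (\<forall>C f. C \<subseteq> U \<and> card C \<le> K \<and> (\<forall>c\<in>C. f c < v) \<longrightarrow> (\<exists>r\<in>F. \<forall>c\<in>C. r c = f c))"

lemma independentD:
  assumes "independent K U v F" "C \<subseteq> U" "card C \<le> K" "\<And>c. c \<in> C \<Longrightarrow> f c < v"
  obtains r where "r \<in> F" "\<And>c. c \<in> C \<Longrightarrow> r c = f c"
proof -
  have "\<exists>r\<in>F. \<forall>c\<in>C. r c = f c"
    using assms(2-4) by (intro assms(1)[unfolded independent_def, rule_format]) auto
  then show ?thesis using that by auto
qed

text \<open>
A uniformly random function takes prescribed values on at most \<open>K\<close> arguments with probability at least
\<open>1 / v ^ K\<close>, and there are at most \<open>(card U * v) ^ K\<close> prescriptions, so a small hitting set exists.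
\<close>

lemma independent_family_exists:
  assumes U: "finite U" "U \<noteq> {}" and v: "v \<ge> 1"
  obtains F :: "('u \<Rightarrow> nat) set" where "finite F" "independent K U v F"
    "card F \<le> real (v ^ K) * (K * ln (real (card U) * v)) + 1"
proof (cases "K = 0")
  case True
  have "independent K U v {\<lambda>_. 0}"
    using U True by (auto simp: independent_def dest: finite_subset)
  then show ?thesis using True by (intro that[of "{\<lambda>_. 0}"]) auto
next
  case K: False
  define \<Omega> where "\<Omega> = PiE U (\<lambda>_. {..<v})"
  define graph where "graph = (\<lambda>(C::'u set, f::'u \<Rightarrow> nat). (\<lambda>c. (c, f c)) ` C)"
  define I where "I = graph ` {(C, f). C \<subseteq> U \<and> C \<noteq> {} \<and> card C \<le> K \<and> (\<forall>c\<in>C. f c < v)}"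
  define R where "R = (\<lambda>r M. \<forall>(c::'u, y::nat)\<in>M. r c = y)"
  have fO: "finite \<Omega>" and cO: "card \<Omega> = v ^ card U"
    using U by (auto simp: \<Omega>_def card_PiE finite_PiE)
  have O_ne: "\<Omega> \<noteq> {}" using v by (auto simp: \<Omega>_def PiE_eq_empty_iff lessThan_empty_iff)
  \<comment> \<open>Prescriptions are counted by listing their graphs, padded to length \<open>K\<close> by repetition.\<close>
  define Ls where "Ls = {ms. set ms \<subseteq> U \<times> {..<v} \<and> length ms = K}"
  have Ls: "finite Ls" "card Ls = (card U * v) ^ K"
    unfolding Ls_def using U by (auto simp: finite_lists_length_eq card_lists_length_eq card_cartesian_product)
  have "I \<subseteq> set ` Ls"
  proof
    fix M assume "M \<in> I"
    then obtain C f where C: "C \<subseteq> U" "C \<noteq> {}" "card C \<le> K" "\<forall>c\<in>C. f c < v" "M = (\<lambda>c. (c, f c)) ` C"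
      by (auto simp: I_def graph_def)
    obtain cs where cs: "set cs = C" "distinct cs"
      using C U finite_distinct_list finite_subset by metis
    define ms where "ms = map (\<lambda>c. (c, f c)) (cs @ replicate (K - length cs) (hd cs))"
    have "length cs \<le> K" "cs \<noteq> []" using cs C distinct_card by fastforce+
    then have "length ms = K" "set ms = M"
      using cs C by (auto simp: ms_def)
    moreover have "M \<subseteq> U \<times> {..<v}" using C by auto
    ultimately show "M \<in> set ` Ls" by (auto simp: Ls_def)
  qed
  then have fI: "finite I" and cI: "card I \<le> (card U * v) ^ K"
    using Ls by (metis finite_imageI finite_subset, metis card_image_le card_mono finite_imageI le_trans)
  obtain u where u: "u \<in> U" using U by blast
  have "graph ({u}, \<lambda>_. 0) \<in> I"
    unfolding I_def using u v K by (intro imageI) auto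
  then have I_ne: "I \<noteq> {}" by blast
  have dense: "card \<Omega> \<le> real (v ^ K) * card {r \<in> \<Omega>. R r M}" if M: "M \<in> I" for M
  proof -
    obtain C f where C: "C \<subseteq> U" "card C \<le> K" "\<forall>c\<in>C. f c < v" "M = (\<lambda>c. (c, f c)) ` C"
      using M by (auto simp: I_def graph_def)
    have "{r \<in> \<Omega>. R r M} = PiE U (\<lambda>u. if u \<in> C then {f u} else {..<v})"
      using C by (fastforce simp: \<Omega>_def R_def PiE_iff extensional_def split: if_splits)
    then have "card {r \<in> \<Omega>. R r M} = (\<Prod>u\<in>U. if u \<in> C then 1 else v)"
      using U by (simp add: card_PiE if_distrib cong: if_cong)
    also have "\<dots> = v ^ card (U - C)"
      using U by (simp add: prod.If_cases Diff_eq)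
    finally have "v ^ card C * card {r \<in> \<Omega>. R r M} = v ^ (card C + card (U - C))"
      by (simp add: power_add)
    also have "card C + card (U - C) = card U"
      using C U by (metis card_Diff_subset card_mono finite_subset le_add_diff_inverse)
    finally have "card \<Omega> = v ^ card C * card {r \<in> \<Omega>. R r M}" using cO by simp
    also have "\<dots> \<le> v ^ K * card {r \<in> \<Omega>. R r M}"
      using C v by (intro mult_right_mono power_increasing) auto
    finally show ?thesis by (metis of_nat_le_iff of_nat_mult)
  qed
  have "\<exists>H \<subseteq> \<Omega>. card H \<le> real (v ^ K) * ln (card I) + 1 \<and> (\<forall>M\<in>I. \<exists>r\<in>H. R r M)"
    using fO O_ne fI I_ne _ dense by (rule small_hitting_set) (use v in simp)
  then obtain H where H: "H \<subseteq> \<Omega>" "card H \<le> real (v ^ K) * ln (card I) + 1"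
    "\<forall>M\<in>I. \<exists>r\<in>H. R r M"
    by blast
  have "card I > 0" using fI I_ne by (simp add: card_gt_0_iff)
  then have "ln (card I) \<le> ln (real ((card U * v) ^ K))"
    using cI U v \<open>card I > 0\<close>
    by (subst ln_le_cancel_iff) (auto simp: card_gt_0_iff simp del: of_nat_power)
  also have "\<dots> = K * ln (real (card U) * v)"
    using U v by (simp add: ln_realpow card_gt_0_iff)
  finally have "real (v ^ K) * ln (card I) \<le> real (v ^ K) * (K * ln (real (card U) * v))"
    by (intro mult_left_mono) auto
  then have 1: "card H \<le> real (v ^ K) * (K * ln (real (card U) * v)) + 1" using H(2) by linarith
  have 2: "\<exists>r\<in>H. \<forall>c\<in>C. r c = f c" if "C \<subseteq> U" "card C \<le> K" "\<forall>c\<in>C. f c < v" for C f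
  proof (cases "C = {}")
    case True
    then show ?thesis using H(3) I_ne by auto
  next
    case False
    then have "graph (C, f) \<in> I" unfolding I_def using that by auto
    then show ?thesis using H(3) by (fastforce simp: R_def graph_def)
  qed
  show ?thesis
  proof (rule that[OF _ _ 1])
    show "finite H" using H(1) fO finite_subset by blast
    show "independent K U v H" unfolding independent_def using 2 by blast
  qed
qed

section \<open>Levels of a set of binary words\<close>

text \<open>
Binary words are represented by the sets of their positions holding a one. The two words part at
position \<open>j\<close>, with \<open>v\<close> taking the zero branch.
\<close>

definition branch :: "nat \<Rightarrow> nat set \<Rightarrow> nat set \<Rightarrow> bool" where
  "branch j v w \<longleftrightarrow> (\<forall>i<j. i \<in> v \<longleftrightarrow> i \<in> w) \<and> j \<notin> v \<and> j \<in> w"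

definition levels :: "nat set set \<Rightarrow> nat set" where
  "levels W = {j. \<exists>v\<in>W. \<exists>w\<in>W. branch j v w}"

lemma levelsI: "v \<in> W \<Longrightarrow> w \<in> W \<Longrightarrow> branch j v w \<Longrightarrow> j \<in> levels W"
  unfolding levels_def by blast

lemma levels_mono: "V \<subseteq> W \<Longrightarrow> levels V \<subseteq> levels W"
  unfolding levels_def by blast

lemma branch_exists:
  assumes "v \<noteq> w"
  shows "\<exists>j. branch j v w \<or> branch j w v"
proof -
  define j where "j = (LEAST j. (j \<in> v) \<noteq> (j \<in> w))"
  have "\<exists>j. (j \<in> v) \<noteq> (j \<in> w)" using assms by blast
  then have "(j \<in> v) \<noteq> (j \<in> w)" unfolding j_def by (rule LeastI_ex)
  moreover have "i \<in> v \<longleftrightarrow> i \<in> w" if "i < j" for i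
    using not_less_Least[OF that[unfolded j_def]] by blast
  ultimately show ?thesis unfolding branch_def by blast
qed

lemma branch_transfer:
  assumes "branch g v w" "\<And>i. i \<le> g \<Longrightarrow> i \<in> v \<longleftrightarrow> i \<in> v'" "\<And>i. i \<le> g \<Longrightarrow> i \<in> w \<longleftrightarrow> i \<in> w'"
  shows "branch g v' w'"
  using assms unfolding branch_def by (meson less_imp_le order_refl)

text \<open>
A word is determined within \<open>W\<close> by its bits at the levels, since the first place at which two words of
\<open>W\<close> differ is a level.
\<close>

lemma card_le_two_power_levels:
  assumes "finite (levels W)"
  shows "card W \<le> 2 ^ card (levels W)"
proof -
  have "inj_on (\<lambda>v. v \<inter> levels W) W"
  proof (rule inj_onI, rule ccontr)
    fix v w assume vw: "v \<in> W" "w \<in> W" "v \<inter> levels W = w \<inter> levels W" "v \<noteq> w"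
    then obtain j where j: "branch j v w \<or> branch j w v" using branch_exists by blast
    then have "j \<in> levels W" using vw levelsI by blast
    then show False using j vw(3) unfolding branch_def by blast
  qed
  then have "card W \<le> card (Pow (levels W))"
    using assms by (intro card_inj_on_le) auto
  then show ?thesis using assms by (simp add: card_Pow)
qed

text \<open>
If all branchings at a level happen at one node, removing a word \<open>a\<close> that takes the zero branch at
the deepest level \<open>j\<close> destroys that level: another word \<open>c\<close> on the same branch would agree with \<open>a\<close> up to and
including \<open>j\<close>, so the two would part at a still deeper level.
\<close>

lemma card_le_levels_if_single_nodes:
  assumes "finite W" "finite (levels W)"
    and "\<And>a b c d j i. \<lbrakk>a \<in> W; b \<in> W; c \<in> W; d \<in> W; branch j a b; branch j c d; i < j\<rbrakk> \<Longrightarrow> i \<in> a \<longleftrightarrow> i \<in> c"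
  shows "card W \<le> card (levels W) + 1"
  using assms
proof (induction W rule: finite_psubset_induct)
  case (psubset W)
  show ?case
  proof (cases "levels W = {}")
    case True
    then show ?thesis using card_le_two_power_levels[OF psubset.prems(1)] by simp
  next
    case False
    define j where "j = Max (levels W)"
    have j: "j \<in> levels W" "\<And>i. i \<in> levels W \<Longrightarrow> i \<le> j"
      using False psubset.prems(1) unfolding j_def by (auto intro: Max_in)
    obtain a b where ab: "a \<in> W" "b \<in> W" "branch j a b" using j(1) unfolding levels_def by blast
    define V where "V = W - {a}"
    have V: "V \<subseteq> W" "V \<subset> W" using ab(1) unfolding V_def by blast+
    have "j \<notin> levels V"
    proof
      assume "j \<in> levels V"
      then obtain c d where cd: "c \<in> V" "d \<in> V" "branch j c d" unfolding levels_def by blast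
      have "c \<in> W" "d \<in> W" "c \<noteq> a" using cd unfolding V_def by auto
      then obtain i where i: "branch i a c \<or> branch i c a" using branch_exists[of a c] by blast
      then have "i \<in> levels W" using levelsI ab(1) \<open>c \<in> W\<close> by blast
      then have "i \<le> j" by (rule j(2))
      have "i' \<in> a \<longleftrightarrow> i' \<in> c" if "i' \<le> j" for i'
        using psubset.prems(2)[OF ab(1,2) \<open>c \<in> W\<close> \<open>d \<in> W\<close> ab(3) cd(3), of i'] that ab(3) cd(3)
        unfolding branch_def by (cases "i' = j") auto
      then show False using i \<open>i \<le> j\<close> unfolding branch_def by blast
    qed
    then have "levels V \<subseteq> levels W - {j}" using levels_mono[OF V(1)] by blast
    then have cl: "card (levels V) \<le> card (levels W) - 1" "finite (levels V)"
      using card_mono[of "levels W - {j}" "levels V"] psubset.prems(1) j(1)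
      by (auto intro: finite_subset)
    have "card V \<le> card (levels V) + 1"
      using V cl(2) psubset.prems(2) by (intro psubset.IH) blast+
    moreover have "card V = card W - 1" using ab(1) psubset.hyps unfolding V_def by simp
    moreover have "card (levels W) > 0" using j(1) psubset.prems(1) by (auto simp: card_gt_0_iff)
    ultimately show ?thesis using cl(1) by linarith
  qed
qed

lemma two_nodes_on_one_level:
  assumes "finite W" "finite (levels W)" "card W > card (levels W) + 1"
  obtains a b c d g j where "a \<in> W" "b \<in> W" "c \<in> W" "d \<in> W"
    "branch j a b" "branch j c d" "branch g a c" "g < j"
proof -
  obtain a b c d j i where el: "a \<in> W" "b \<in> W" "c \<in> W" "d \<in> W" "branch j a b" "branch j c d"
    "i < j" "(i \<in> a) \<noteq> (i \<in> c)"
  proof (rule ccontr)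
    assume none: "\<not> thesis"
    have "card W \<le> card (levels W) + 1"
    proof (rule card_le_levels_if_single_nodes[OF assms(1,2)], rule ccontr)
      fix a b c d j i
      assume "a \<in> W" "b \<in> W" "c \<in> W" "d \<in> W" "branch j a b" "branch j c d" "i < j" "(i \<in> a) \<noteq> (i \<in> c)"
      then have thesis by (rule that)
      then show False using none by blast
    qed
    then show False using assms(3) by simp
  qed
  obtain g where g: "branch g a c \<or> branch g c a" using branch_exists[of a c] el(8) by blast
  then have "g \<le> i" using el(8) unfolding branch_def by (meson not_le)
  then have "g < j" using el(7) by simp
  from g show ?thesis
  proof
    assume "branch g a c"
    then show ?thesis using \<open>g < j\<close> el by (intro that[of a b c d j g]) auto
  next
    assume "branch g c a"
    then show ?thesis using \<open>g < j\<close> el by (intro that[of c d a b j g]) auto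
  qed
qed

section \<open>Reversing levels of the lexicographic order\<close>

text \<open>
Points are compared by the ranks that \<open>r\<close> gives to their letters, the letter of \<open>x\<close> at place \<open>i\<close> being
\<open>\<phi> i x\<close>. Two points are only guaranteed to compare as intended if \<open>r\<close> separates their first
differing letters.
\<close>

definition lex_order :: "(nat \<times> 'l \<Rightarrow> nat) \<Rightarrow> (nat \<Rightarrow> nat \<Rightarrow> 'l) \<Rightarrow> nat \<Rightarrow> nat \<Rightarrow> nat rel" where
  "lex_order r \<phi> d n = key_order (\<lambda>x. map (\<lambda>i. r (i, \<phi> i x)) [0..<d]) {1..n}"

lemma lex_order_less:
  assumes "x \<in> {1..n}" "y \<in> {1..n}" "i < d" "\<And>j. j < i \<Longrightarrow> \<phi> j x = \<phi> j y"
    and "r (i, \<phi> i x) < r (i, \<phi> i y)"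
  shows "(x, y) \<in> lex_order r \<phi> d n" "(y, x) \<notin> lex_order r \<phi> d n"
proof -
  have "map (\<lambda>i. r (i, \<phi> i x)) [0..<d] < map (\<lambda>i. r (i, \<phi> i y)) [0..<d]"
    using assms(3-) by (intro list_less_at_first_difference[of i]) auto
  then show "(x, y) \<in> lex_order r \<phi> d n" "(y, x) \<notin> lex_order r \<phi> d n"
    unfolding lex_order_def by (rule key_order_less[OF assms(1,2)])+
qed

definition flip_orders :: "(nat \<Rightarrow> nat set) \<Rightarrow> nat \<Rightarrow> (nat \<times> bool \<Rightarrow> nat) set \<Rightarrow> nat \<Rightarrow> nat rel set" where
  "flip_orders code D F n = (\<lambda>r. lex_order r (\<lambda>j x. j \<in> code x) D n) ` F"

text \<open>
The level \<open>j\<close> is reversed exactly if \<open>j\<close> lies in \<open>S\<close>. This needs prescribed ranks for the two bits at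
each position in \<open>B\<close>, whence twice the cardinality; positions outside \<open>B\<close> are not controlled.
\<close>

lemma flip_patterns:
  assumes F: "independent K ({..<D} \<times> UNIV) 2 F"
    and X: "X \<subseteq> {1..n}" and B: "finite B" "B \<subseteq> {..<D}" "2 * card B \<le> K"
  obtains pat where "\<And>S. S \<subseteq> B \<Longrightarrow> pat S \<in> patterns (flip_orders code D F n) X"
    "\<And>S x y j. \<lbrakk>S \<subseteq> B; x \<in> X; y \<in> X; j \<in> B; branch j (code x) (code y)\<rbrakk> \<Longrightarrow> (x, y) \<in> pat S \<longleftrightarrow> j \<notin> S"
proof -
  have "\<exists>p \<in> patterns (flip_orders code D F n) X.
      \<forall>x\<in>X. \<forall>y\<in>X. \<forall>j\<in>B. branch j (code x) (code y) \<longrightarrow> ((x, y) \<in> p \<longleftrightarrow> j \<notin> S)" for S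
  proof -
    define f where "f = (\<lambda>(j, b). of_bool (b \<noteq> (j \<in> S)) :: nat)"
    obtain r where r: "r \<in> F" "\<And>c. c \<in> B \<times> UNIV \<Longrightarrow> r c = f c"
      by (rule independentD[OF F, of "B \<times> UNIV" f])
        (use B in \<open>auto simp: f_def card_cartesian_product\<close>)
    define q where "q = lex_order r (\<lambda>j x. j \<in> code x) D n"
    have "(x, y) \<in> q \<longleftrightarrow> j \<notin> S" if xy: "x \<in> X" "y \<in> X" "j \<in> B" "branch j (code x) (code y)" for x y j
    proof -
      have bits: "j \<notin> code x" "j \<in> code y" "\<And>i. i < j \<Longrightarrow> (i \<in> code x) = (i \<in> code y)"
        using xy(4) unfolding branch_def by auto
      have mem: "x \<in> {1..n}" "y \<in> {1..n}" "j < D" using xy X B by auto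
      show ?thesis
      proof (cases "j \<in> S")
        case True
        then have "r (j, j \<in> code y) < r (j, j \<in> code x)" using r(2) xy(3) bits by (simp add: f_def)
        then show ?thesis
          using True lex_order_less(2)[of y n x j D "\<lambda>j x. j \<in> code x" r] mem bits by (simp add: q_def)
      next
        case False
        then have "r (j, j \<in> code x) < r (j, j \<in> code y)" using r(2) xy(3) bits by (simp add: f_def)
        then show ?thesis
          using False lex_order_less(1)[of x n y j D "\<lambda>j x. j \<in> code x" r] mem bits by (simp add: q_def)
      qed
    qed
    moreover have "induced_perm q X \<in> patterns (flip_orders code D F n) X"
      using r(1) unfolding q_def flip_orders_def by blast
    ultimately show ?thesis by (intro bexI[of _ "induced_perm q X"]) auto
  qed
  then obtain pat where p: "\<And>S. pat S \<in> patterns (flip_orders code D F n) X"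
    "\<And>S x y j. \<lbrakk>x \<in> X; y \<in> X; j \<in> B; branch j (code x) (code y)\<rbrakk> \<Longrightarrow> (x, y) \<in> pat S \<longleftrightarrow> j \<notin> S"
    by metis
  show ?thesis
  proof (rule that[of pat])
    show "pat S \<in> patterns (flip_orders code D F n) X" for S by (rule p(1))
    show "(x, y) \<in> pat S \<longleftrightarrow> j \<notin> S"
      if "x \<in> X" "y \<in> X" "j \<in> B" "branch j (code x) (code y)" for S x y j
      using that by (rule p(2))
  qed
qed

lemma flip_patterns_inj:
  assumes "B \<subseteq> levels (code ` X)"
    and "\<And>S x y j. \<lbrakk>S \<subseteq> B; x \<in> X; y \<in> X; j \<in> B; branch j (code x) (code y)\<rbrakk> \<Longrightarrow> (x, y) \<in> pat S \<longleftrightarrow> j \<notin> S"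
  shows "inj_on pat (Pow B)"
proof (rule inj_onI)
  fix S T assume ST: "S \<in> Pow B" "T \<in> Pow B" "pat S = pat T"
  have "j \<in> S \<longleftrightarrow> j \<in> T" if j: "j \<in> B" for j
  proof -
    obtain x y where "x \<in> X" "y \<in> X" "branch j (code x) (code y)"
      using assms(1) j unfolding levels_def by blast
    then show ?thesis using assms(2)[of S x y j] assms(2)[of T x y j] ST j by simp
  qed
  then show "S = T" using ST by blast
qed

lemma levels_subset:
  assumes "\<And>x. x \<in> {1..n} \<Longrightarrow> code x \<subseteq> {..<D}" "X \<subseteq> {1..n}"
  shows "levels (code ` X) \<subseteq> {..<D}"
  using assms unfolding levels_def branch_def by blast

text \<open>
The hypothesis says that \<open>L\<close> is at most the binary logarithm of the size of \<open>X\<close>, rounded up.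
\<close>

lemma many_levels:
  assumes "\<And>x. x \<in> {1..n} \<Longrightarrow> code x \<subseteq> {..<D}" "inj_on code {1..n}"
    and "X \<subseteq> {1..n}" "2 ^ L < 2 * card X"
  shows "L \<le> card (levels (code ` X))"
proof -
  have "levels (code ` X) \<subseteq> {..<D}" using levels_subset[of n code D X] assms(1,3) by blast
  then have "finite (levels (code ` X))" using finite_subset by blast
  from card_le_two_power_levels[OF this] have "card X \<le> 2 ^ card (levels (code ` X))"
    using assms(2,3) by (metis card_image inj_on_subset)
  then have "2 ^ L < 2 * (2::nat) ^ card (levels (code ` X))" using assms(4) by linarith
  then have "(2::nat) ^ L < 2 ^ Suc (card (levels (code ` X)))" by simp
  then show ?thesis by (simp only: power_strict_increasing_iff)
qed

lemma card_flip_patterns_ge: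
  assumes F: "independent K ({..<D} \<times> UNIV) 2 F" "finite F"
    and code: "\<And>x. x \<in> {1..n} \<Longrightarrow> code x \<subseteq> {..<D}"
    and X: "X \<subseteq> {1..n}" and L: "L \<le> card (levels (code ` X))" "2 * L \<le> K"
  shows "2 ^ L \<le> card (patterns (flip_orders code D F n) X)"
proof -
  obtain B where B: "B \<subseteq> levels (code ` X)" "card B = L"
    using L(1) obtain_subset_with_card_n by metis
  have BD: "B \<subseteq> {..<D}" using levels_subset[of n code D X] code X B(1) by blast
  then have fB: "finite B" using finite_subset by blast
  obtain pat where pat: "\<And>S. S \<subseteq> B \<Longrightarrow> pat S \<in> patterns (flip_orders code D F n) X"
    "\<And>S x y j. \<lbrakk>S \<subseteq> B; x \<in> X; y \<in> X; j \<in> B; branch j (code x) (code y)\<rbrakk> \<Longrightarrow> (x, y) \<in> pat S \<longleftrightarrow> j \<notin> S"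
    using flip_patterns[OF F(1) X fB BD, of code] B(2) L(2) by metis
  have "card (pat ` Pow B) = 2 ^ L"
    using flip_patterns_inj[OF B(1) pat(2)] fB B(2) by (simp add: card_image card_Pow)
  moreover have "card (pat ` Pow B) \<le> card (patterns (flip_orders code D F n) X)"
    using pat(1) F(2) by (intro card_mono) (auto simp: flip_orders_def)
  ultimately show ?thesis by simp
qed

section \<open>Ranking the letters of a word\<close>

definition block :: "nat \<Rightarrow> nat \<Rightarrow> nat set \<Rightarrow> nat set" where
  "block b i w = w \<inter> {i * b..<Suc i * b}"

lemma block_mem: "0 < b \<Longrightarrow> t \<in> block b i w \<longleftrightarrow> t \<in> w \<and> t div b = i"
  unfolding block_def
  using div_nat_eqI[of b i t] div_times_less_eq_dividend[of t b] dividend_less_div_times[of b t]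
  by (auto simp: mult.commute)

lemma block_eqI:
  assumes "0 < b" "\<And>t. t div b = i \<Longrightarrow> t \<in> v \<longleftrightarrow> t \<in> w"
  shows "block b i v = block b i w"
  using assms by (auto simp: block_mem)

lemma block_eq_below_branch:
  assumes "0 < b" "branch j v w" "i < j div b"
  shows "block b i v = block b i w"
proof (rule block_eqI[OF assms(1)])
  fix t assume "t div b = i"
  then have "t < j" using assms(3) by (metis div_le_mono leD not_le)
  then show "t \<in> v \<longleftrightarrow> t \<in> w" using assms(2) unfolding branch_def by blast
qed

lemma block_differs: "0 < b \<Longrightarrow> (t \<in> v) \<noteq> (t \<in> w) \<Longrightarrow> block b (t div b) v \<noteq> block b (t div b) w"
  by (metis block_mem)

text \<open>
The inequalities \<open>x < y\<close> and \<open>w < z\<close> could only conflict by forming the cycle \<open>x < y = w < z = x\<close>.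
\<close>

lemma opposed_ranking_aux:
  assumes "x \<noteq> y" "z \<noteq> w" "x \<noteq> w" "y \<noteq> z" "x \<noteq> z \<or> y \<noteq> w"
  shows "\<exists>e :: 'a \<Rightarrow> nat. (\<forall>s. e s < 4) \<and> e x < e y \<and> e w < e z"
proof (cases "x = z")
  case False
  then show ?thesis
    using assms by (intro exI[of _ "\<lambda>s. if s = x then 0 else if s = z then 2 else 1"]) auto
next
  case True
  then show ?thesis
    using assms by (intro exI[of _ "\<lambda>s. if s = w then 0 else if s = y then 2 else 1"]) auto
qed

definition prescribed :: "bool \<Rightarrow> nat \<Rightarrow> nat \<Rightarrow> bool" where
  "prescribed u p q \<longleftrightarrow> (if u then p < q else q < p)"

lemma opposed_ranking:
  assumes "x \<noteq> y" "z \<noteq> w" "x \<noteq> w" "y \<noteq> z" "x \<noteq> z \<or> y \<noteq> w"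
  shows "\<exists>e :: 'a \<Rightarrow> nat. (\<forall>s. e s < 4) \<and> prescribed u (e x) (e y) \<and> prescribed (\<not> u) (e z) (e w)"
proof (cases u)
  case True
  then show ?thesis using opposed_ranking_aux[OF assms] by (auto simp: prescribed_def)
next
  case False
  then show ?thesis using opposed_ranking_aux[of y x w z] assms by (auto simp: prescribed_def)
qed

lemma opposed_ranking_distinct:
  assumes "distinct [x, y, z, w]"
  shows "\<exists>e :: 'a \<Rightarrow> nat. (\<forall>s. e s < 4) \<and> prescribed u (e x) (e y) \<and> prescribed (\<not> u) (e z) (e w) \<and>
    prescribed v (e x) (e z)"
proof -
  define p where "p = (if v then 0 else 2::nat)"
  define q where "q = (if v then 2 else 0::nat)"
  define e where "e = (\<lambda>s. if s = x then p + of_bool (\<not> u) else if s = y then p + of_bool u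
    else if s = z then q + of_bool u else if s = w then q + of_bool (\<not> u) else (0::nat))"
  have "e x = p + of_bool (\<not> u)" "e y = p + of_bool u" "e z = q + of_bool u" "e w = q + of_bool (\<not> u)"
    using assms by (auto simp: e_def)
  moreover have "\<forall>s. e s < 4" by (auto simp: e_def p_def q_def)
  ultimately show ?thesis by (intro exI[of _ e]) (auto simp: prescribed_def p_def q_def)
qed

lemma lex_order_iff:
  assumes "x \<in> {1..n}" "y \<in> {1..n}" "i < d" "\<And>j. j < i \<Longrightarrow> \<phi> j x = \<phi> j y"
    and "prescribed u (r (i, \<phi> i x)) (r (i, \<phi> i y))"
  shows "(x, y) \<in> lex_order r \<phi> d n \<longleftrightarrow> u"
  using lex_order_less(1)[of x n y i d \<phi> r] lex_order_less(2)[of y n x i d \<phi> r] assms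
  by (auto simp: prescribed_def split: if_splits)

definition letter_orders :: "(nat \<Rightarrow> nat set) \<Rightarrow> nat \<Rightarrow> nat \<Rightarrow> (nat \<times> nat set \<Rightarrow> nat) set \<Rightarrow> nat \<Rightarrow> nat rel set" where
  "letter_orders code b d F n = (\<lambda>r. lex_order r (\<lambda>i x. block b i (code x)) d n) ` F"

abbreviation letter_cells :: "nat \<Rightarrow> nat \<Rightarrow> (nat \<times> nat set) set" where
  "letter_cells b d \<equiv> (SIGMA i:{..<d}. Pow {i * b..<Suc i * b})"

text \<open>
The letters at place \<open>j div b\<close> can be ranked so that \<open>x\<close>, \<open>y\<close> and \<open>z\<close>, \<open>w\<close> compare in opposite senses.
The order of \<open>x\<close> and \<open>z\<close> is decided where their words part: at an earlier place this choice is free,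
and at the same place all four letters are distinct and every order is available. At most six
letter ranks are prescribed.
\<close>

lemma letter_patterns:
  assumes F: "independent 6 (letter_cells b d) 4 F" and b: "0 < b"
    and code: "\<And>x. x \<in> {1..n} \<Longrightarrow> code x \<subseteq> {..<d * b}"
    and mem: "x \<in> {1..n}" "y \<in> {1..n}" "z \<in> {1..n}" "w \<in> {1..n}"
    and br: "branch j (code x) (code y)" "branch j (code z) (code w)" "branch g (code x) (code z)" "g < j"
    and diff: "block b (j div b) (code x) \<noteq> block b (j div b) (code z) \<or>
      block b (j div b) (code y) \<noteq> block b (j div b) (code w)"
  shows "\<exists>q\<in>letter_orders code b d F n.
    ((x, y) \<in> q \<longleftrightarrow> u) \<and> ((z, w) \<in> q \<longleftrightarrow> \<not> u) \<and> ((x, z) \<in> q \<longleftrightarrow> v)"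
proof -
  \<comment> \<open>The pairs part at place \<open>i\<close>, and the two pairs part from each other at place \<open>h\<close>.\<close>
  define i where "i = j div b"
  define h where "h = g div b"
  define \<phi> where "\<phi> = (\<lambda>i x. block b i (code x))"
  have hi: "h \<le> i" using br(4) by (simp add: h_def i_def div_le_mono)
  have "j < d * b" using br(1) code[OF mem(2)] unfolding branch_def by auto
  then have i: "i < d" using b by (simp add: i_def less_mult_imp_div_less)
  have below: "\<And>l. l < i \<Longrightarrow> \<phi> l x = \<phi> l y" "\<And>l. l < i \<Longrightarrow> \<phi> l z = \<phi> l w" "\<And>l. l < h \<Longrightarrow> \<phi> l x = \<phi> l z"
    using block_eq_below_branch[OF b] br(1-3) by (auto simp: \<phi>_def i_def h_def)
  have ne: "\<phi> i x \<noteq> \<phi> i y" "\<phi> i z \<noteq> \<phi> i w" "\<phi> i x \<noteq> \<phi> i w" "\<phi> i y \<noteq> \<phi> i z"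
    using block_differs[OF b, of j] br(1,2) unfolding \<phi>_def i_def branch_def by blast+
  have ne_diff: "\<phi> i x \<noteq> \<phi> i z \<or> \<phi> i y \<noteq> \<phi> i w" using diff by (simp add: \<phi>_def i_def)
  have neh: "\<phi> h x \<noteq> \<phi> h z"
    using block_differs[OF b, of g] br(3) unfolding \<phi>_def h_def branch_def by blast
  have neh': "\<phi> h y \<noteq> \<phi> h w"
  proof -
    have "(g \<in> code y) \<noteq> (g \<in> code w)" using br unfolding branch_def by blast
    then show ?thesis using block_differs[OF b, of g] unfolding \<phi>_def h_def by blast
  qed
  define C where "C = {(i, \<phi> i x), (i, \<phi> i y), (i, \<phi> i z), (i, \<phi> i w), (h, \<phi> h x), (h, \<phi> h z)}"
  have C: "C \<subseteq> letter_cells b d" "card C \<le> 6"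
    using i hi by (auto simp: C_def \<phi>_def block_def card_insert_if)
  have "\<exists>f. (\<forall>c. f c < 4) \<and> prescribed u (f (i, \<phi> i x)) (f (i, \<phi> i y)) \<and>
      prescribed (\<not> u) (f (i, \<phi> i z)) (f (i, \<phi> i w)) \<and> prescribed v (f (h, \<phi> h x)) (f (h, \<phi> h z))"
  proof (cases "h = i")
    case True
    have "distinct [\<phi> i x, \<phi> i y, \<phi> i z, \<phi> i w]" using ne neh neh' True by auto
    then obtain e :: "nat set \<Rightarrow> nat" where "\<forall>s. e s < 4" "prescribed u (e (\<phi> i x)) (e (\<phi> i y))"
      "prescribed (\<not> u) (e (\<phi> i z)) (e (\<phi> i w))" "prescribed v (e (\<phi> i x)) (e (\<phi> i z))"
      using opposed_ranking_distinct[of "\<phi> i x" "\<phi> i y" "\<phi> i z" "\<phi> i w" u v] by blast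
    then show ?thesis using True by (intro exI[of _ "\<lambda>(l, s). e s"]) auto
  next
    case False
    obtain e :: "nat set \<Rightarrow> nat" where "\<forall>s. e s < 4" "prescribed u (e (\<phi> i x)) (e (\<phi> i y))"
      "prescribed (\<not> u) (e (\<phi> i z)) (e (\<phi> i w))"
      using opposed_ranking[OF ne ne_diff, of u] by (elim exE conjE) (rule that)
    then show ?thesis using False neh
      by (intro exI[of _ "\<lambda>(l, s). if l = i then e s else of_bool ((s = \<phi> h x) \<noteq> v)"])
        (auto simp: prescribed_def)
  qed
  then obtain f where f: "\<forall>c. f c < 4" "prescribed u (f (i, \<phi> i x)) (f (i, \<phi> i y))"
      "prescribed (\<not> u) (f (i, \<phi> i z)) (f (i, \<phi> i w))" "prescribed v (f (h, \<phi> h x)) (f (h, \<phi> h z))"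
    by blast
  obtain r where r: "r \<in> F" "\<And>c. c \<in> C \<Longrightarrow> r c = f c"
    by (rule independentD[OF F C, of f]) (use f(1) in auto)
  have rC: "r (i, \<phi> i x) = f (i, \<phi> i x)" "r (i, \<phi> i y) = f (i, \<phi> i y)" "r (i, \<phi> i z) = f (i, \<phi> i z)"
    "r (i, \<phi> i w) = f (i, \<phi> i w)" "r (h, \<phi> h x) = f (h, \<phi> h x)" "r (h, \<phi> h z) = f (h, \<phi> h z)"
    by (rule r(2), simp add: C_def)+
  define q where "q = lex_order r \<phi> d n"
  have "(x, y) \<in> q \<longleftrightarrow> u" unfolding q_def
    using mem i below(1) f(2) rC by (intro lex_order_iff[of _ _ _ i]) auto
  moreover have "(z, w) \<in> q \<longleftrightarrow> \<not> u" unfolding q_def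
    using mem i below(2) f(3) rC by (intro lex_order_iff[of _ _ _ i]) auto
  moreover have "(x, z) \<in> q \<longleftrightarrow> v" unfolding q_def
    using mem i hi below(3) f(4) rC by (intro lex_order_iff[of _ _ _ h]) auto
  moreover have "q \<in> letter_orders code b d F n"
    unfolding q_def \<phi>_def letter_orders_def using r(1) by blast
  ultimately show ?thesis by blast
qed
section \<open>Reading one letter first\<close>

text \<open>
Block \<open>i\<close> is read first and then the whole word; \<open>s\<close> reverses the comparison of the blocks and \<open>s'\<close>
that of the words. When block \<open>i\<close> is met again inside the word, it is already known to be equal.
\<close>

definition block_first_key :: "nat \<Rightarrow> nat \<Rightarrow> nat \<Rightarrow> bool \<Rightarrow> bool \<Rightarrow> nat set \<Rightarrow> bool list" where
  "block_first_key b D i s s' w =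
    map (\<lambda>t. (t \<in> w) \<noteq> s) [i * b..<Suc i * b] @ map (\<lambda>t. (t \<in> w) \<noteq> s') [0..<D]"

definition block_first_order ::
  "(nat \<Rightarrow> nat set) \<Rightarrow> nat \<Rightarrow> nat \<Rightarrow> nat \<Rightarrow> bool \<Rightarrow> bool \<Rightarrow> nat \<Rightarrow> nat rel" where
  "block_first_order code b D i s s' n = key_order (\<lambda>x. block_first_key b D i s s' (code x)) {1..n}"

definition block_first_orders :: "(nat \<Rightarrow> nat set) \<Rightarrow> nat \<Rightarrow> nat \<Rightarrow> nat \<Rightarrow> nat rel set" where
  "block_first_orders code b d n =
    (\<lambda>(i, s, s'). block_first_order code b (d * b) i s s' n) ` ({..<d} \<times> UNIV \<times> UNIV)"

lemma map_upt_append_less: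
  fixes f g :: "nat \<Rightarrow> 'a::linorder"
  assumes "lo \<le> t" "t < hi" "\<And>j. lo \<le> j \<Longrightarrow> j < t \<Longrightarrow> f j = g j" "f t < g t"
  shows "map f [lo..<hi] @ us < map g [lo..<hi] @ vs"
proof (rule list_less_at_first_difference[of "t - lo"])
  show "t - lo < length (map f [lo..<hi] @ us)" "t - lo < length (map g [lo..<hi] @ vs)"
    using assms(1,2) by auto
  show "(map f [lo..<hi] @ us) ! j = (map g [lo..<hi] @ vs) ! j" if "j < t - lo" for j
      proof -
    have "j < hi - lo" "lo + j < t" using that assms(1,2) by linarith+
    then show ?thesis using assms(3)[of "lo + j"] by (simp add: nth_append)
  qed
  show "(map f [lo..<hi] @ us) ! (t - lo) < (map g [lo..<hi] @ vs) ! (t - lo)"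
  proof -
    have "t - lo < hi - lo" "lo + (t - lo) = t" using assms(1,2) by linarith+
    then show ?thesis using assms(4) by (simp add: nth_append)
  qed
qed

lemma bool_less_if: "(\<not> p) \<Longrightarrow> q \<Longrightarrow> p < q" for p q :: bool
  by auto

lemma block_first_order_in_block:
  assumes mem: "x \<in> {1..n}" "y \<in> {1..n}"
    and t: "i * b \<le> t" "t < Suc i * b" "\<And>l. i * b \<le> l \<Longrightarrow> l < t \<Longrightarrow> l \<in> code x \<longleftrightarrow> l \<in> code y"
      "t \<notin> code x" "t \<in> code y"
  shows "(x, y) \<in> block_first_order code b D i s s' n \<longleftrightarrow> \<not> s"
    "(y, x) \<in> block_first_order code b D i s s' n \<longleftrightarrow> s"
proof -
  have "if s then block_first_key b D i s s' (code y) < block_first_key b D i s s' (code x)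
    else block_first_key b D i s s' (code x) < block_first_key b D i s s' (code y)"
    unfolding block_first_key_def using t
    by (auto intro!: map_upt_append_less[of _ t] bool_less_if)
  then show "(x, y) \<in> block_first_order code b D i s s' n \<longleftrightarrow> \<not> s"
    "(y, x) \<in> block_first_order code b D i s s' n \<longleftrightarrow> s"
    using mem unfolding block_first_order_def key_order_def by (auto split: if_splits)
qed

lemma block_first_order_same_block:
  assumes mem: "x \<in> {1..n}" "y \<in> {1..n}"
    and same: "block b i (code x) = block b i (code y)"
    and br: "branch g (code x) (code y)" "g < D"
  shows "(x, y) \<in> block_first_order code b D i s s' n \<longleftrightarrow> \<not> s'"
proof -
  have "t \<in> code x \<longleftrightarrow> t \<in> code y" if "t \<in> {i * b..<Suc i * b}" for t
    using same that unfolding block_def by blast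
  then have pre: "map (\<lambda>t. (t \<in> code x) \<noteq> s) [i * b..<Suc i * b] = map (\<lambda>t. (t \<in> code y) \<noteq> s) [i * b..<Suc i * b]"
    by (intro map_cong) (auto simp del: upt_Suc)
  have tail: "map f [0..<D] < map h [0..<D]" if "\<And>t. t < g \<Longrightarrow> f t = h t" "f g < h g" for f h :: "nat \<Rightarrow> bool"
    using map_upt_append_less[of 0 g D f h "[]" "[]"] that br(2) by simp
  have tail: "if s' then map (\<lambda>t. (t \<in> code y) \<noteq> s') [0..<D] < map (\<lambda>t. (t \<in> code x) \<noteq> s') [0..<D]
    else map (\<lambda>t. (t \<in> code x) \<noteq> s') [0..<D] < map (\<lambda>t. (t \<in> code y) \<noteq> s') [0..<D]"
    using br unfolding branch_def by (auto intro!: tail bool_less_if)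
  have app: "us < vs \<Longrightarrow> zs @ us < zs @ vs" for us vs zs :: "bool list"
    unfolding list_less_def by (rule lexord_append_leftI)
  have "if s' then block_first_key b D i s s' (code y) < block_first_key b D i s s' (code x)
    else block_first_key b D i s s' (code x) < block_first_key b D i s s' (code y)"
    unfolding block_first_key_def pre using tail app by (auto split: if_splits)
  then show "(x, y) \<in> block_first_order code b D i s s' n \<longleftrightarrow> \<not> s'"
    using mem unfolding block_first_order_def key_order_def by (auto split: if_splits)
qed

text \<open>
Block \<open>j div b\<close> separates \<open>x\<close>, \<open>z\<close> from \<open>y\<close>, \<open>w\<close>, in a sense given by \<open>u\<close>. It does not separate
\<open>x\<close> from \<open>z\<close>, so their order is that of the full words, in a sense given by \<open>v\<close>.
\<close>

lemma block_first_patterns: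
  assumes b: "0 < b"
    and code: "\<And>x. x \<in> {1..n} \<Longrightarrow> code x \<subseteq> {..<d * b}"
    and mem: "x \<in> {1..n}" "y \<in> {1..n}" "z \<in> {1..n}" "w \<in> {1..n}"
    and br: "branch j (code x) (code y)" "branch j (code z) (code w)" "branch g (code x) (code z)" "g < j"
    and same: "block b (j div b) (code x) = block b (j div b) (code z)"
      "block b (j div b) (code y) = block b (j div b) (code w)"
  shows "\<exists>q\<in>block_first_orders code b d n.
    ((x, y) \<in> q \<longleftrightarrow> u) \<and> ((x, w) \<in> q \<longleftrightarrow> u) \<and> ((y, z) \<in> q \<longleftrightarrow> \<not> u) \<and> ((x, z) \<in> q \<longleftrightarrow> v)"
proof -
  define i where "i = j div b"
  define q where "q = block_first_order code b (d * b) i (\<not> u) (\<not> v) n"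
  have j: "j < d * b" using br(1) code[OF mem(2)] unfolding branch_def by auto
  then have i: "i < d" using b by (simp add: i_def less_mult_imp_div_less)
  have ji: "i * b \<le> j" "j < Suc i * b"
    using b by (simp_all add: i_def div_times_less_eq_dividend dividend_less_div_times)
  have in_block: "l \<in> block b i c \<longleftrightarrow> l \<in> c" if "i * b \<le> l" "l < j" for l c
    using that ji unfolding block_def by auto
  have agree: "l \<in> code x \<longleftrightarrow> l \<in> code y" "l \<in> code x \<longleftrightarrow> l \<in> code w" "l \<in> code z \<longleftrightarrow> l \<in> code y"
    if l: "i * b \<le> l" "l < j" for l
  proof -
    have 1: "l \<in> code x \<longleftrightarrow> l \<in> code y" "l \<in> code z \<longleftrightarrow> l \<in> code w"
      using l(2) br(1,2) unfolding branch_def by blast+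
    have 2: "l \<in> code x \<longleftrightarrow> l \<in> code z"
      using in_block[OF l] same(1) unfolding i_def[symmetric] by metis
    show "l \<in> code x \<longleftrightarrow> l \<in> code y" "l \<in> code x \<longleftrightarrow> l \<in> code w" "l \<in> code z \<longleftrightarrow> l \<in> code y"
      using 1 2 by auto
  qed
  have bits: "j \<notin> code x" "j \<in> code y" "j \<notin> code z" "j \<in> code w"
    using br unfolding branch_def by auto
  have "(x, y) \<in> q \<longleftrightarrow> u"
    unfolding q_def using block_first_order_in_block(1)[of x n y i b j code] mem ji agree bits by simp
  moreover have "(x, w) \<in> q \<longleftrightarrow> u"
    unfolding q_def using block_first_order_in_block(1)[of x n w i b j code] mem ji agree bits by simp
  moreover have "(y, z) \<in> q \<longleftrightarrow> \<not> u"
    unfolding q_def using block_first_order_in_block(2)[of z n y i b j code] mem ji agree bits by simp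
  moreover have "(x, z) \<in> q \<longleftrightarrow> v"
    unfolding q_def
    using block_first_order_same_block[of x n z b i code g "d * b"] mem same(1) br(3,4) j
    unfolding i_def[symmetric] by simp
  moreover have "q \<in> block_first_orders code b d n"
    unfolding q_def block_first_orders_def using i by (intro image_eqI[of _ _ "(i, \<not> u, \<not> v)"]) auto
  ultimately show ?thesis by blast
qed

section \<open>Four further patterns\<close>

text \<open>
Reversals of levels treat the two nodes above \<open>x\<close>, \<open>y\<close> and above \<open>z\<close>, \<open>w\<close> alike and keep the pairs apart;
the predicate \<open>good\<close> below records the consequences of this. The four further patterns violate it, and
differ from each other in the order of \<open>x\<close>, \<open>y\<close> or of \<open>x\<close>, \<open>z\<close>.
\<close>

lemma combined_orders_shatter:
  assumes FA: "independent K ({..<d * b} \<times> UNIV) 2 FA" "finite FA" "2 * (L + 1) \<le> K"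
    and FB: "independent 6 (letter_cells b d) 4 FB" "finite FB" and b: "0 < b"
    and code: "\<And>x. x \<in> {1..n} \<Longrightarrow> code x \<subseteq> {..<d * b}" "inj_on code {1..n}"
    and X: "X \<subseteq> {1..n}" "card X = k"
    and k: "4 \<le> k" "2 ^ L < 2 * k" "k \<le> 2 ^ L" and t: "t \<le> 2 * k" "t \<le> 2 ^ L + 4"
  shows "shatters t (flip_orders code (d * b) FA n \<union> letter_orders code b d FB n \<union>
    block_first_orders code b d n) X"
proof -
  let ?A = "flip_orders code (d * b) FA n"
  let ?N = "letter_orders code b d FB n \<union> block_first_orders code b d n"
  let ?W = "code ` X"
  have finX: "finite X" using X finite_subset by blast
  have finA: "finite ?A" and finN: "finite ?N"
    using FA(2) FB(2) by (auto simp: flip_orders_def letter_orders_def block_first_orders_def)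
  have lev: "levels ?W \<subseteq> {..<d * b}" using levels_subset[of n code "d * b" X] code(1) X(1) by blast
  then have fl: "finite (levels ?W)" using finite_subset by blast
  have cW: "card ?W = k" using X code(2) by (metis card_image inj_on_subset)
  have L: "L \<le> card (levels ?W)" using many_levels[OF code X(1)] X(2) k(2) by simp
  show ?thesis
  proof (cases "L = card (levels ?W)")
    case False
    then have "2 ^ (L + 1) \<le> card (patterns ?A X)"
      using L FA by (intro card_flip_patterns_ge[OF FA(1,2) code(1) X(1)]) auto
    also have "\<dots> \<le> card (patterns (?A \<union> letter_orders code b d FB n \<union> block_first_orders code b d n) X)"
      using finA finN by (intro card_mono) auto
    finally show ?thesis using k(3) t(1) unfolding shatters_def by simp
  next
    case True
    \<comment> \<open>Here \<open>k \<ge> 4\<close> is essential: for \<open>k = 3\<close> the two levels may have one node each.\<close>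
    have "L + 1 < k"
    proof (cases "L \<le> 2")
      case False
      obtain l where l: "L = l + 3" using False by (metis add.commute le_Suc_ex not_less_eq_eq numeral_3_eq_3 numeral_2_eq_2)
      have "l + 4 \<le> 2 ^ (l + 2)" by (induction l) auto
      moreover have "2 * (2::nat) ^ (l + 2) = 2 ^ L" by (simp add: l power_add)
      ultimately show ?thesis using k(2) l by linarith
    qed (use k(1) in linarith)
    then have "card ?W > card (levels ?W) + 1" using cW True by simp
    then obtain a' b' c' d' g j where br': "a' \<in> ?W" "b' \<in> ?W" "c' \<in> ?W" "d' \<in> ?W"
      "branch j a' b'" "branch j c' d'" "branch g a' c'" "g < j"
      by (rule two_nodes_on_one_level[OF finite_imageI[OF finX] fl])
    obtain x y z w where xyzw: "x \<in> X" "y \<in> X" "z \<in> X" "w \<in> X"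
      and eqs: "a' = code x" "b' = code y" "c' = code z" "d' = code w"
      using br'(1-4) by (elim imageE)
    have br: "branch j (code x) (code y)" "branch j (code z) (code w)" "branch g (code x) (code z)"
      using br'(5-7) eqs by auto
    have mem: "x \<in> {1..n}" "y \<in> {1..n}" "z \<in> {1..n}" "w \<in> {1..n}" using xyzw X(1) by auto
    have gj: "g < j" by (rule br'(8))
    have br2: "branch g (code x) (code w)" "branch g (code y) (code z)"
      using br gj by (auto intro!: branch_transfer[OF br(3)]) (auto simp: branch_def)
    define good where "good = (\<lambda>p. ((x, y) \<in> p \<longleftrightarrow> (z, w) \<in> p) \<and> ((x, w) \<in> p \<longleftrightarrow> (y, z) \<in> p))"
    have lv: "j \<in> levels ?W" "g \<in> levels ?W" using xyzw br by (auto intro: levelsI)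
    obtain pat where pat: "\<And>S. S \<subseteq> levels ?W \<Longrightarrow> pat S \<in> patterns ?A X"
      "\<And>S x y j. \<lbrakk>S \<subseteq> levels ?W; x \<in> X; y \<in> X; j \<in> levels ?W; branch j (code x) (code y)\<rbrakk>
        \<Longrightarrow> (x, y) \<in> pat S \<longleftrightarrow> j \<notin> S"
      using flip_patterns[OF FA(1) X(1) fl lev, of code] FA(3) True by auto
    have good: "good (pat S)" if "S \<subseteq> levels ?W" for S
      using pat(2)[OF that] xyzw br br2 lv by (simp add: good_def)
    have c1: "card (pat ` Pow (levels ?W)) = 2 ^ L"
      using flip_patterns_inj[OF order_refl pat(2)] fl True by (simp add: card_image card_Pow)
    have "\<exists>q\<in>?N. ((x, y) \<in> q \<longleftrightarrow> u) \<and> ((x, z) \<in> q \<longleftrightarrow> v) \<and> \<not> good q" for u v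
    proof (cases "block b (j div b) (code x) = block b (j div b) (code z) \<and>
        block b (j div b) (code y) = block b (j div b) (code w)")
      case True
      then have "\<exists>q\<in>block_first_orders code b d n.
          ((x, y) \<in> q \<longleftrightarrow> u) \<and> ((x, w) \<in> q \<longleftrightarrow> u) \<and> ((y, z) \<in> q \<longleftrightarrow> \<not> u) \<and> ((x, z) \<in> q \<longleftrightarrow> v)"
        by (intro block_first_patterns[OF b code(1) mem br gj]) auto
      then show ?thesis unfolding good_def by blast
    next
      case False
      then have "\<exists>q\<in>letter_orders code b d FB n.
          ((x, y) \<in> q \<longleftrightarrow> u) \<and> ((z, w) \<in> q \<longleftrightarrow> \<not> u) \<and> ((x, z) \<in> q \<longleftrightarrow> v)"
        by (intro letter_patterns[OF FB(1) b code(1) mem br gj]) auto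
      then show ?thesis unfolding good_def by blast
    qed
    then obtain new where new: "\<And>u v. new u v \<in> ?N" "\<And>u v. (x, y) \<in> new u v \<longleftrightarrow> u"
      "\<And>u v. (x, z) \<in> new u v \<longleftrightarrow> v" "\<And>u v. \<not> good (new u v)"
      by metis
    define npat where "npat = (\<lambda>(u, v). induced_perm (new u v) X)"
    have "inj npat"
    proof (rule injI)
      fix c c' assume e: "npat c = npat c'"
      obtain u v where c: "c = (u, v)" by (cases c)
      obtain u' v' where c': "c' = (u', v')" by (cases c')
      have "(x, y) \<in> npat c \<longleftrightarrow> u" "(x, z) \<in> npat c \<longleftrightarrow> v" "(x, y) \<in> npat c' \<longleftrightarrow> u'" "(x, z) \<in> npat c' \<longleftrightarrow> v'"
        using new(2,3) xyzw by (auto simp: npat_def c c')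
      then show "c = c'" using e c c' by simp
    qed
    then have c2: "card (range npat) = 4" by (simp add: card_image card_UNIV_bool flip: UNIV_Times_UNIV)
    have bad: "\<not> good (npat c)" for c
      using new(4) xyzw by (auto simp: npat_def good_def split: prod.splits)
    have "pat ` Pow (levels ?W) \<inter> range npat = {}"
    proof (rule equals0I, elim IntE imageE)
      fix p S c assume "S \<in> Pow (levels ?W)" "p = pat S" "p = npat c"
      then show False using good[of S] bad[of c] by simp
    qed
    then have "card (pat ` Pow (levels ?W) \<union> range npat) = 2 ^ L + 4"
      using c1 c2 fl by (subst card_Un_disjoint) auto
    moreover have "card (pat ` Pow (levels ?W) \<union> range npat) \<le>
        card (patterns (?A \<union> letter_orders code b d FB n \<union> block_first_orders code b d n) X)"
    proof (rule card_mono)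
      show "finite (patterns (?A \<union> letter_orders code b d FB n \<union> block_first_orders code b d n) X)"
        using finA finN by simp
      have "range npat \<subseteq> patterns ?N X" using new(1) by (auto simp: npat_def)
      then show "pat ` Pow (levels ?W) \<union> range npat \<subseteq>
          patterns (?A \<union> letter_orders code b d FB n \<union> block_first_orders code b d n) X"
        using pat(1) by (simp only: image_Un) blast
    qed
    ultimately show ?thesis using t(2) unfolding shatters_def by linarith
  qed
qed
section \<open>Upper bounds\<close>

lemma bit_code_exists:
  assumes "n \<le> 2 ^ D"
  obtains code :: "nat \<Rightarrow> nat set" where "\<And>x. x \<in> {1..n} \<Longrightarrow> code x \<subseteq> {..<D}" "inj_on code {1..n}"
proof -
  have "\<exists>code. code ` {1..n} \<subseteq> Pow {..<D} \<and> inj_on code {1..n}"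
    using assms by (intro card_le_inj) (auto simp: card_Pow)
  then obtain code where code: "code ` {1..n} \<subseteq> Pow {..<D}" "inj_on code {1..n}" by blast
  show ?thesis
  proof (rule that[OF _ code(2)])
    show "code x \<subseteq> {..<D}" if "x \<in> {1..n}" for x using code(1) that by blast
  qed
qed

lemma lex_order_in_perms: "lex_order r \<phi> d n \<in> perms {1..n}"
  unfolding lex_order_def by (rule key_order_in_perms)

lemma flip_orders_in_perms: "flip_orders code D F n \<subseteq> perms {1..n}"
  unfolding flip_orders_def using lex_order_in_perms by blast

lemma letter_orders_in_perms: "letter_orders code b d F n \<subseteq> perms {1..n}"
  unfolding letter_orders_def using lex_order_in_perms by blast

lemma block_first_orders_in_perms: "block_first_orders code b d n \<subseteq> perms {1..n}"
  unfolding block_first_orders_def block_first_order_def using key_order_in_perms by fastforce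

text \<open>
Both keys map \<open>X\<close> bijectively onto an initial segment of the naturals, so the key of a point is the number
of points of \<open>X\<close> before it in the pattern.
\<close>

lemma ranking_pattern_inj:
  fixes e f g :: "'a::linorder \<Rightarrow> nat" and p q :: "'a \<Rightarrow> 'a"
  assumes X: "X \<subseteq> Y" "finite X" and e: "bij_betw e X {0..<k}"
    and pq: "p permutes X" "q permutes X"
    and agree: "\<And>x. x \<in> X \<Longrightarrow> f x = e (p x)" "\<And>x. x \<in> X \<Longrightarrow> g x = e (q x)"
    and eq: "induced_perm (key_order f Y) X = induced_perm (key_order g Y) X"
  shows "p = q"
proof -
  have rank: "e (s x) = card {y \<in> X. y \<noteq> x \<and> (y, x) \<in> induced_perm (key_order h Y) X}"
    if s: "s permutes X" and h: "\<And>x. x \<in> X \<Longrightarrow> h x = e (s x)" and x: "x \<in> X"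
    for s and h :: "'a \<Rightarrow> nat" and x
  proof -
    have bij: "bij_betw (e \<circ> s) X {0..<k}"
      using permutes_imp_bij[OF s] e by (rule bij_betw_trans)
    then have inj: "inj_on (e \<circ> s) X" and im: "(e \<circ> s) ` X = {0..<k}" by (auto simp: bij_betw_def)
    have "(e \<circ> s) ` {y \<in> X. (e \<circ> s) y < (e \<circ> s) x} = {0..<(e \<circ> s) x}"
    proof
      show "{0..<(e \<circ> s) x} \<subseteq> (e \<circ> s) ` {y \<in> X. (e \<circ> s) y < (e \<circ> s) x}"
      proof
        fix i assume i: "i \<in> {0..<(e \<circ> s) x}"
        have "(e \<circ> s) x \<in> {0..<k}" using im x by blast
        then have "i \<in> (e \<circ> s) ` X" using i im by auto
        then show "i \<in> (e \<circ> s) ` {y \<in> X. (e \<circ> s) y < (e \<circ> s) x}" using i by auto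
      qed
    qed auto
    moreover have "card ((e \<circ> s) ` {y \<in> X. (e \<circ> s) y < (e \<circ> s) x}) = card {y \<in> X. (e \<circ> s) y < (e \<circ> s) x}"
      by (intro card_image inj_on_subset[OF inj]) auto
    ultimately have "(e \<circ> s) x = card {y \<in> X. (e \<circ> s) y < (e \<circ> s) x}" by simp
    also have "{y \<in> X. (e \<circ> s) y < (e \<circ> s) x} = {y \<in> X. y \<noteq> x \<and> (y, x) \<in> induced_perm (key_order h Y) X}"
    proof (intro Collect_cong conj_cong refl)
      fix y assume y: "y \<in> X"
      have "(e \<circ> s) y = (e \<circ> s) x \<longleftrightarrow> y = x" using inj y x by (meson inj_on_eq_iff)
      then show "(e \<circ> s) y < (e \<circ> s) x \<longleftrightarrow> y \<noteq> x \<and> (y, x) \<in> induced_perm (key_order h Y) X"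
        using h[OF y] h[OF x] x y X by (auto simp: key_order_def)
    qed
    finally show ?thesis by simp
  qed
  have "p x = q x" for x
  proof (cases "x \<in> X")
    case True
    have "e (p x) = e (q x)"
      using rank[OF pq(1) agree(1) True] rank[OF pq(2) agree(2) True] eq by simp
    moreover have "p x \<in> X" "q x \<in> X" using True pq by (simp_all add: permutes_in_image)
    ultimately show ?thesis using e by (meson bij_betw_def inj_on_eq_iff)
  next
    case False
    then show ?thesis using pq by (simp add: permutes_not_in)
  qed
  then show ?thesis by blast
qed

text \<open>
Each ranking of a \<open>k\<close>-element set prescribes \<open>k\<close> values below \<open>k\<close>.
\<close>

lemma all_patterns_family:
  assumes "k \<ge> 1" "n \<ge> 1"
  obtains P where "P \<subseteq> perms {1..n}" "card P \<le> real (k ^ k) * (k * ln (real n * k)) + 1"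
    "\<And>X. X \<subseteq> {1..n} \<Longrightarrow> card X = k \<Longrightarrow> shatters (fact k) P X"
proof -
  obtain F :: "(nat \<Rightarrow> nat) set" where F: "finite F" "independent k {1..n} k F"
    "card F \<le> real (k ^ k) * (k * ln (real (card {1..n}) * k)) + 1"
    by (rule independent_family_exists[of "{1..n}" k k]) (use assms in auto)
  define P where "P = (\<lambda>r. key_order r {1..n}) ` F"
  show ?thesis
  proof (rule that[of P])
    show "P \<subseteq> perms {1..n}" using key_order_in_perms by (auto simp: P_def simp del: One_nat_def)
    have "card P \<le> card F" unfolding P_def using F(1) by (rule card_image_le)
    then show "card P \<le> real (k ^ k) * (k * ln (real n * k)) + 1" using F(3) by simp
    fix X assume X: "X \<subseteq> {1..n}" "card X = k"
    have finX: "finite X" using X(1) finite_subset by blast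
    obtain e where e: "bij_betw e X {0..<k}" using ex_bij_betw_finite_nat[OF finX] X(2) by auto
    have "\<exists>r\<in>F. \<forall>x\<in>X. r x = e (p x)" if p: "p permutes X" for p
    proof -
      have "e (p x) < k" if "x \<in> X" for x
        using bij_betw_apply[OF e] that p by (auto simp: permutes_in_image)
      then obtain r where "r \<in> F" "\<And>x. x \<in> X \<Longrightarrow> r x = e (p x)"
        using independentD[OF F(2) X(1), of "\<lambda>x. e (p x)"] X(2) by auto
      then show ?thesis by blast
    qed
    then obtain R where R: "\<And>p. p permutes X \<Longrightarrow> R p \<in> F" "\<And>p x. p permutes X \<Longrightarrow> x \<in> X \<Longrightarrow> R p x = e (p x)"
      by metis
    define pat where "pat = (\<lambda>p. induced_perm (key_order (R p) {1..n}) X)"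
    have "inj_on pat {p. p permutes X}"
    proof (rule inj_onI)
      fix p q assume "p \<in> {p. p permutes X}" "q \<in> {p. p permutes X}" "pat p = pat q"
      then show "p = q"
        using ranking_pattern_inj[OF X(1) finX e, of p q "R p" "R q"] R(2) by (simp add: pat_def)
    qed
    then have "card (pat ` {p. p permutes X}) = fact k"
      using card_permutations[OF X(2) finX] by (simp add: card_image)
    moreover have "card (pat ` {p. p permutes X}) \<le> card (patterns P X)"
    proof (rule card_mono)
      show "finite (patterns P X)" using F(1) by (simp add: P_def)
      show "pat ` {p. p permutes X} \<subseteq> patterns P X" using R(1) by (auto simp: pat_def P_def)
    qed
    ultimately show "shatters (fact k) P X" unfolding shatters_def by simp
  qed
qed

lemma shatters_antimono: "shatters t P X \<Longrightarrow> s \<le> t \<Longrightarrow> shatters s P X"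
  unfolding shatters_def by linarith

lemma optimal_family_exists:
  assumes "k \<ge> 1" "n \<ge> 1" "t \<le> fact k"
  obtains Q where "Q \<subseteq> perms {1..n}" "card Q = shatter_num k n t"
    "\<And>X. X \<subseteq> {1..n} \<Longrightarrow> card X = k \<Longrightarrow> shatters t Q X"
proof -
  obtain P where P: "P \<subseteq> perms {1..n}" "\<And>X. X \<subseteq> {1..n} \<Longrightarrow> card X = k \<Longrightarrow> shatters (fact k) P X"
    using all_patterns_family[OF assms(1,2)] by metis
  show ?thesis
  proof (rule shatter_num_attained[OF P(1), of k t])
    fix X assume "X \<subseteq> {1..n}" "card X = k"
    then show "shatters t P X" using shatters_antimono[OF P(2) assms(3)] by simp
  next
    fix Q assume "Q \<subseteq> perms {1..n}" "card Q = shatter_num k n t"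
      "\<And>X. X \<subseteq> {1..n} \<Longrightarrow> card X = k \<Longrightarrow> shatters t Q X"
    then show ?thesis by (rule that)
  qed
qed

lemma shatter_num_ge:
  assumes "k \<ge> 1" "n \<ge> k" "t \<le> fact k"
  shows "t \<le> shatter_num k n t"
proof -
  obtain Q where Q: "Q \<subseteq> perms {1..n}" "card Q = shatter_num k n t"
    "\<And>X. X \<subseteq> {1..n} \<Longrightarrow> card X = k \<Longrightarrow> shatters t Q X"
    using optimal_family_exists[of k n t] assms by auto
  have "shatters t Q {1..k}" using Q(3) assms(2) by simp
  then show ?thesis using shattering_family_card_ge Q by metis
qed

lemma shatter_num_le_log:
  assumes "k \<ge> 1" "n \<ge> 1" "t \<le> fact k"
  shows "shatter_num k n t \<le> real (k ^ k) * (k * ln (real n * k)) + 1"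
proof -
  obtain P where P: "P \<subseteq> perms {1..n}" "card P \<le> real (k ^ k) * (k * ln (real n * k)) + 1"
    "\<And>X. X \<subseteq> {1..n} \<Longrightarrow> card X = k \<Longrightarrow> shatters (fact k) P X"
    using all_patterns_family[OF assms(1,2)] by metis
  have "shatter_num k n t \<le> card P"
    using P(1) by (rule shatter_num_le) (use shatters_antimono[OF P(3) assms(3)] in blast)
  then show ?thesis using P(2) by linarith
qed

lemma shatter_num_le_loglog:
  assumes n: "n \<le> 2 ^ D" "D \<ge> 1" and k: "2 ^ L < 2 * k" and t: "t \<le> 2 ^ L"
  shows "shatter_num k n t \<le> real (2 ^ (2 * L)) * (real (2 * L) * ln (4 * real D)) + 1"
proof -
  obtain code where code: "\<And>x. x \<in> {1..n} \<Longrightarrow> code x \<subseteq> {..<D}" "inj_on code {1..n}"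
    using bit_code_exists[OF n(1)] by metis
  obtain F :: "(nat \<times> bool \<Rightarrow> nat) set" where F: "finite F" "independent (2 * L) ({..<D} \<times> UNIV) 2 F"
    "card F \<le> real (2 ^ (2 * L)) * (real (2 * L) * ln (real (card ({..<D} \<times> (UNIV :: bool set))) * real 2)) + 1"
    by (rule independent_family_exists[of "{..<D} \<times> (UNIV :: bool set)" 2 "2 * L"])
      (use n(2) in \<open>auto simp: lessThan_empty_iff\<close>)
  have cF: "card F \<le> real (2 ^ (2 * L)) * (real (2 * L) * ln (4 * real D)) + 1"
    using F(3) by (simp add: card_cartesian_product mult_ac)
  have "shatter_num k n t \<le> card (flip_orders code D F n)"
  proof (rule shatter_num_le[OF flip_orders_in_perms])
    fix X assume X: "X \<subseteq> {1..n}" "card X = k"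
    have "L \<le> card (levels (code ` X))" using many_levels[OF code X(1)] X(2) k by simp
    then have "2 ^ L \<le> card (patterns (flip_orders code D F n) X)"
      by (intro card_flip_patterns_ge[OF F(2,1) code(1) X(1)]) auto
    then show "shatters t (flip_orders code D F n) X" unfolding shatters_def using t by linarith
  qed
  also have "card (flip_orders code D F n) \<le> card F"
    unfolding flip_orders_def using F(1) by (rule card_image_le)
  finally show ?thesis using cF by linarith
qed

text \<open>
With words of \<open>d\<close> letters of \<open>d\<close> bits, there are \<open>d * 2 ^ d\<close> pairs of a place and a letter there, so that
ranking letters takes \<open>O(d)\<close> permutations. Reading one letter first takes four permutations for each place, and
reversing levels takes only \<open>O(ln d)\<close>, which is bounded crudely by \<open>ln x \<le> x\<close>.
\<close>

lemma shatter_num_le_sqrt_log: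
  assumes n: "n \<le> 2 ^ (d * d)" "d \<ge> 1" and k: "4 \<le> k" "2 ^ L < 2 * k" "k \<le> 2 ^ L"
    and t: "t \<le> 2 * k" "t \<le> 2 ^ L + 4"
  shows "shatter_num k n t \<le> (real (2 ^ (2 * (L + 1))) * real (2 * (L + 1)) * 4 + 4 ^ 6 * 30 + 4) * d + 2"
proof -
  define K where "K = 2 * (L + 1)"
  obtain code where code: "\<And>x. x \<in> {1..n} \<Longrightarrow> code x \<subseteq> {..<d * d}" "inj_on code {1..n}"
    using bit_code_exists[OF n(1)] by metis
  obtain FA :: "(nat \<times> bool \<Rightarrow> nat) set" where FA: "finite FA" "independent K ({..<d * d} \<times> UNIV) 2 FA"
    "card FA \<le> real (2 ^ K) * (K * ln (real (card ({..<d * d} \<times> (UNIV :: bool set))) * real 2)) + 1"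
    by (rule independent_family_exists[of "{..<d * d} \<times> (UNIV :: bool set)" 2 K])
      (use n(2) in \<open>auto simp: lessThan_empty_iff\<close>)
  have ln_le: "ln x \<le> x" if "x > 0" for x :: real using ln_le_minus_one[OF that] by linarith
  have "ln (real (card ({..<d * d} \<times> (UNIV :: bool set))) * real 2) = ln ((2 * real d) ^ 2)"
    by (simp add: card_cartesian_product power2_eq_square mult_ac)
  also have "\<dots> = 2 * ln (2 * real d)" using ln_realpow[of "2 * real d" 2] n(2) by simp
  also have "\<dots> \<le> 4 * d" using ln_le[of "2 * real d"] n(2) by simp
  finally have "real (2 ^ K) * (K * ln (real (card ({..<d * d} \<times> (UNIV :: bool set))) * real 2)) \<le>
      real (2 ^ K) * (real K * real (4 * d))"
    by (rule mult_left_mono[OF mult_left_mono]) auto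
  then have cA: "card FA \<le> real (2 ^ K) * real K * 4 * d + 1" using FA(3) by (simp add: mult_ac)
  have "(0, {}) \<in> letter_cells d d" using n(2) by auto
  then have cells: "finite (letter_cells d d)" "letter_cells d d \<noteq> {}" "card (letter_cells d d) = d * 2 ^ d"
    by (blast | simp add: card_SigmaI card_Pow)+
  obtain FB :: "(nat \<times> nat set \<Rightarrow> nat) set" where FB: "finite FB" "independent 6 (letter_cells d d) 4 FB"
    "card FB \<le> real (4 ^ 6) * (real 6 * ln (real (card (letter_cells d d)) * real 4)) + 1"
    by (rule independent_family_exists[OF cells(1,2), of 4 6]) auto
  have "ln (real (card (letter_cells d d)) * real 4) = ln (4 * real d) + d * ln 2"
    using n(2) unfolding cells(3) by (simp add: ln_mult ln_realpow)
  also have "\<dots> \<le> 4 * real d + real d * 1"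
    using ln_le[of "4 * real d"] n(2) ln_2_less_1 by (intro add_mono mult_left_mono) auto
  finally have cB: "card FB \<le> 4 ^ 6 * 30 * real d + 1" using FB(3) by simp
  let ?A = "flip_orders code (d * d) FA n" and ?B = "letter_orders code d d FB n"
    and ?C = "block_first_orders code d d n"
  have "shatter_num k n t \<le> card (?A \<union> ?B \<union> ?C)"
  proof (rule shatter_num_le)
    show "?A \<union> ?B \<union> ?C \<subseteq> perms {1..n}"
      using flip_orders_in_perms letter_orders_in_perms block_first_orders_in_perms by blast
    show "shatters t (?A \<union> ?B \<union> ?C) X" if "X \<subseteq> {1..n}" "card X = k" for X
      using that n(2) k t
      by (intro combined_orders_shatter[OF FA(2,1) _ FB(2,1) _ code]) (auto simp: K_def)
  qed
  also have "\<dots> \<le> card ?A + card ?B + card ?C"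
    by (meson add_le_mono1 card_Un_le le_trans)
  also have "\<dots> \<le> card FA + card FB + d * 4"
  proof (intro add_mono)
    show "card ?A \<le> card FA" unfolding flip_orders_def using FA(1) by (rule card_image_le)
    show "card ?B \<le> card FB" unfolding letter_orders_def using FB(1) by (rule card_image_le)
    have "card ?C \<le> card ({..<d} \<times> (UNIV :: bool set) \<times> (UNIV :: bool set))"
      unfolding block_first_orders_def by (rule card_image_le) simp
    then show "card ?C \<le> d * 4" by (simp add: card_cartesian_product del: UNIV_Times_UNIV)
  qed
  finally have "real (shatter_num k n t) \<le> real (card FA + card FB + d * 4)" by (simp only: of_nat_le_iff)
  then show ?thesis using cA cB unfolding K_def by (simp add: algebra_simps)
qed

section \<open>The four regimes\<close>

text \<open>
Additive constants are harmless because \<open>g\<close> tends to infinity and \<open>f\<close> is at least one.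
\<close>

lemma bigtheta_if_affine_bounds:
  fixes f :: "nat \<Rightarrow> nat" and g :: "nat \<Rightarrow> real" and a b c e :: real
  assumes g: "filterlim g at_top sequentially"
    and upper: "\<And>n. n \<ge> N \<Longrightarrow> f n \<le> a * g n + b"
    and lower: "\<And>n. n \<ge> N \<Longrightarrow> g n \<le> c * f n + e"
    and pos: "\<And>n. n \<ge> N \<Longrightarrow> f n \<ge> 1"
  shows "(\<lambda>n. real (f n)) \<in> \<Theta>(g)"
proof (rule bigthetaI)
  have ev: "eventually (\<lambda>n. n \<ge> N \<and> g n \<ge> 1) sequentially"
    using g by (intro eventually_conj eventually_ge_at_top) (simp add: filterlim_at_top)
  show "(\<lambda>n. real (f n)) \<in> O(g)"
  proof (rule bigoI[of _ "\<bar>a\<bar> + \<bar>b\<bar>"], use ev in eventually_elim)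
    case (elim n)
    have "real (f n) \<le> a * g n + b" using upper elim by blast
    also have "\<dots> \<le> \<bar>a\<bar> * g n + \<bar>b\<bar> * g n"
      using elim mult_right_mono[of a "\<bar>a\<bar>" "g n"] mult_left_mono[of 1 "g n" "\<bar>b\<bar>"] by linarith
    finally show ?case using elim by (simp add: algebra_simps)
  qed
  have "g \<in> O(\<lambda>n. real (f n))"
  proof (rule bigoI[of _ "\<bar>c\<bar> + \<bar>e\<bar>"], use ev in eventually_elim)
    case (elim n)
    have f1: "real (f n) \<ge> 1" using pos elim by simp
    have "g n \<le> c * f n + e" using lower elim by blast
    also have "\<dots> \<le> \<bar>c\<bar> * f n + \<bar>e\<bar> * f n"
      using f1 mult_right_mono[of c "\<bar>c\<bar>" "real (f n)"] mult_left_mono[of 1 "real (f n)" "\<bar>e\<bar>"] by linarith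
    finally show ?case using elim by (simp add: algebra_simps)
  qed
  then show "(\<lambda>n. real (f n)) \<in> \<Omega>(g)" by (simp add: bigomega_iff_bigo)
qed

lemma filterlim_ln_nat: "filterlim (\<lambda>n. ln (real n)) at_top sequentially"
  by (rule filterlim_compose[OF ln_at_top filterlim_real_sequentially])

lemma ln_ge_1: "n \<ge> 3 \<Longrightarrow> ln (real n) \<ge> 1"
  using exp_le by (subst ln_ge_iff) auto

lemma shatter_num_log_regime:
  assumes "k \<ge> 2" "2 ^ (k - 1) < t" "t \<le> fact k"
  shows "(\<lambda>n. real (shatter_num k n t)) \<in> \<Theta>(\<lambda>n. ln (real n))"
proof (rule bigtheta_if_affine_bounds[OF filterlim_ln_nat, where N = k])
  fix n assume n: "n \<ge> k"
  have "1 \<le> t" using assms(2) by simp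
  then show "1 \<le> shatter_num k n t" using shatter_num_ge[of k n t] assms n by linarith
  have "shatter_num k n t \<le> real (k ^ k) * (k * ln (real n * k)) + 1"
    using assms n by (intro shatter_num_le_log) auto
  also have "ln (real n * k) = ln n + ln k" using assms n by (intro ln_mult_pos) auto
  finally show "shatter_num k n t \<le> (real (k ^ k) * k) * ln n + (real (k ^ k) * k * ln k + 1)"
    by (simp add: algebra_simps)
  obtain Q where Q: "Q \<subseteq> perms {1..n}" "card Q = shatter_num k n t"
    "\<And>X. X \<subseteq> {1..n} \<Longrightarrow> card X = k \<Longrightarrow> shatters t Q X"
    using optimal_family_exists[of k n t] assms n by auto
  have "n < 2 ^ ((shatter_num k n t + 1) * (k - 1))"
    using card_less_if_shatters_many[OF Q(1,3) _ assms(2)] Q(2) assms(1) by simp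
  then have "real n \<le> 2 ^ ((shatter_num k n t + 1) * (k - 1))"
    by (metis less_imp_le of_nat_le_iff of_nat_numeral of_nat_power)
  then have "ln n \<le> ln ((2::real) ^ ((shatter_num k n t + 1) * (k - 1)))"
    using assms n by (subst ln_le_cancel_iff) auto
  also have "\<dots> = (real (shatter_num k n t) + 1) * real (k - 1) * ln 2"
    unfolding ln_realpow by (simp only: of_nat_mult of_nat_add of_nat_1)
  also have "\<dots> = (real (k - 1) * ln 2) * real (shatter_num k n t) + real (k - 1) * ln 2"
    by algebra
  finally show "ln n \<le> (real (k - 1) * ln 2) * real (shatter_num k n t) + real (k - 1) * ln 2" .
qed

lemma shatter_num_loglog_regime:
  assumes k: "k \<ge> 3" "2 ^ L < 2 * k" and t: "3 \<le> t" "t \<le> 2 ^ L" "t \<le> fact k"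
  shows "(\<lambda>n. real (shatter_num k n t)) \<in> \<Theta>(\<lambda>n. ln (ln (real n)))"
proof (rule bigtheta_if_affine_bounds[OF filterlim_compose[OF ln_at_top filterlim_ln_nat], where N = "max 3 k"])
  fix n assume "n \<ge> max 3 k"
  then have n: "n \<ge> 3" "n \<ge> k" by auto
  show "1 \<le> shatter_num k n t" using shatter_num_ge[of k n t] t k n by linarith
  define D where "D = nat \<lceil>log 2 n\<rceil>"
  have ln1: "ln (real n) \<ge> 1" using ln_ge_1 n by simp
  have log1: "log 2 n \<ge> 1" using n by (simp add: le_log_iff)
  have D: "log 2 n \<le> D" "D \<le> log 2 n + 1" "D \<ge> 1" using log1 unfolding D_def by linarith+
  have "real n = 2 powr log 2 n" using n by simp
  also have "\<dots> \<le> 2 powr D" using D(1) by (intro powr_mono) auto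
  finally have "real n \<le> 2 ^ D" by (simp add: powr_realpow)
  then have nD: "n \<le> 2 ^ D" by (metis of_nat_le_iff of_nat_numeral of_nat_power)
  have "4 * real D \<le> 8 * log 2 n" using D(2) log1 by linarith
  also have "\<dots> = 8 / ln 2 * ln n" by (simp add: log_def)
  finally have "ln (4 * real D) \<le> ln (8 / ln 2 * ln n)" using D(3) ln1 by (subst ln_le_cancel_iff) auto
  also have "\<dots> = ln (8 / ln 2) + ln (ln n)" using ln1 by (intro ln_mult_pos) auto
  finally have "real (2 ^ (2 * L)) * (real (2 * L) * ln (4 * real D)) \<le> real (2 ^ (2 * L)) * (real (2 * L) * (ln (8 / ln 2) + ln (ln n)))"
    by (intro mult_left_mono) auto
  then have "shatter_num k n t \<le> real (2 ^ (2 * L)) * (real (2 * L) * (ln (8 / ln 2) + ln (ln n))) + 1"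
    using shatter_num_le_loglog[OF nD D(3) k(2) t(2)] by linarith
  then show "shatter_num k n t \<le> (real (2 ^ (2 * L)) * real (2 * L)) * ln (ln n) +
      (real (2 ^ (2 * L)) * real (2 * L) * ln (8 / ln 2) + 1)"
    by (simp add: algebra_simps)
  obtain Q where Q: "Q \<subseteq> perms {1..n}" "card Q = shatter_num k n t"
    "\<And>X. X \<subseteq> {1..n} \<Longrightarrow> card X = k \<Longrightarrow> shatters t Q X"
    using optimal_family_exists[of k n t] k t n by auto
  define m where "m = shatter_num k n t"
  have "n \<le> (k - 1) ^ 2 ^ m"
    using card_le_if_shatters_three[OF Q(1,3) _ t(1)] Q(2) k(1) unfolding m_def by simp
  then have "real n \<le> real (k - 1) ^ 2 ^ m" by (metis of_nat_le_iff of_nat_power)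
  then have "ln n \<le> ln (real (k - 1) ^ 2 ^ m)"
    using k(1) n by (subst ln_le_cancel_iff) auto
  also have "\<dots> = 2 ^ m * ln (k - 1)" using k(1) by (simp add: ln_realpow)
  finally have "ln (ln n) \<le> ln (2 ^ m * ln (real (k - 1)))"
    using ln1 k(1) by (subst ln_le_cancel_iff) auto
  also have "\<dots> = m * ln 2 + ln (ln (real (k - 1)))"
    using k(1) by (subst ln_mult) (auto simp: ln_realpow)
  finally show "ln (ln n) \<le> ln 2 * shatter_num k n t + ln (ln (real (k - 1)))"
    unfolding m_def by (simp add: mult.commute)
qed

lemma shatter_num_sqrt_log_regime:
  assumes k: "k \<ge> 4" "2 ^ L < 2 * k" "k \<le> 2 ^ L"
    and t: "2 ^ L < t" "t \<le> 2 * k" "t \<le> 2 ^ L + 4" "t \<le> fact k"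
  shows "(\<lambda>n. real (shatter_num k n t)) \<in> \<Theta>(\<lambda>n. sqrt (ln (real n)))"
proof (rule bigtheta_if_affine_bounds[OF filterlim_compose[OF sqrt_at_top filterlim_ln_nat], where N = k])
  fix n assume n: "n \<ge> k"
  show "1 \<le> shatter_num k n t" using shatter_num_ge[of k n t] t k n by linarith
  define d where "d = nat \<lceil>sqrt (log 2 n)\<rceil>"
  have log1: "log 2 n \<ge> 1" using n k by (simp add: le_log_iff)
  then have "sqrt (log 2 n) \<ge> 1" by simp
  then have d: "sqrt (log 2 n) \<le> d" "d \<le> sqrt (log 2 n) + 1" "d \<ge> 1" unfolding d_def by linarith+
  have "log 2 n \<le> real d ^ 2" using d(1) by (rule sqrt_le_D)
  then have "2 powr log 2 n \<le> 2 powr real (d * d)" by (intro powr_mono) (auto simp: power2_eq_square)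
  then have "real n \<le> 2 ^ (d * d)" using n k by (simp add: powr_realpow del: of_nat_mult)
  then have nd: "n \<le> 2 ^ (d * d)" by (metis of_nat_le_iff of_nat_numeral of_nat_power)
  define c where "c = real (2 ^ (2 * (L + 1))) * real (2 * (L + 1)) * 4 + 4 ^ 6 * 30 + 4"
  have "shatter_num k n t \<le> c * d + 2"
    using shatter_num_le_sqrt_log[OF nd d(3) k t(2,3)] unfolding c_def .
  also have "c * d \<le> c * (sqrt (log 2 n) + 1)" using d(2) by (intro mult_left_mono) (auto simp: c_def)
  also have "sqrt (log 2 n) = sqrt (ln n) / sqrt (ln 2)" by (simp add: log_def real_sqrt_divide)
  finally show "shatter_num k n t \<le> (c / sqrt (ln 2)) * sqrt (ln n) + (c + 2)"
    by (simp add: algebra_simps)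
  obtain Q where Q: "Q \<subseteq> perms {1..n}" "card Q = shatter_num k n t"
    "\<And>X. X \<subseteq> {1..n} \<Longrightarrow> card X = k \<Longrightarrow> shatters t Q X"
    using optimal_family_exists[of k n t] k t n by auto
  define m where "m = shatter_num k n t"
  have "n < 2 ^ ((m + 1)\<^sup>2 * L\<^sup>2)"
    using card_less_if_shatters_above_tree[OF Q(1,3) k(3) t(1)] Q(2) unfolding m_def by simp
  then have "real n \<le> 2 ^ ((m + 1)\<^sup>2 * L\<^sup>2)"
    by (metis less_imp_le of_nat_le_iff of_nat_numeral of_nat_power)
  then have "ln n \<le> ln ((2::real) ^ ((m + 1)\<^sup>2 * L\<^sup>2))"
    using k(1) n by (subst ln_le_cancel_iff) auto
  also have "\<dots> = ((real m + 1) * L)\<^sup>2 * ln 2" by (simp add: ln_realpow power_mult_distrib)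
  also have "\<dots> \<le> ((real m + 1) * L)\<^sup>2 * 1" using ln_2_less_1 by (intro mult_left_mono) auto
  finally have "sqrt (ln n) \<le> (real m + 1) * L" by (intro real_le_lsqrt) auto
  then show "sqrt (ln n) \<le> real L * real (shatter_num k n t) + real L" unfolding m_def by (simp add: algebra_simps)
qed

lemma ceiling_log_bounds:
  assumes "k \<ge> 1"
  shows "k \<le> 2 ^ nat \<lceil>log 2 (real k)\<rceil>" "2 ^ nat \<lceil>log 2 (real k)\<rceil> < 2 * k"
proof -
  define L where "L = nat \<lceil>log 2 (real k)\<rceil>"
  have "log 2 k \<ge> 0" using assms by simp
  then have L: "log 2 k \<le> L" "L < log 2 k + 1" unfolding L_def by linarith+
  have k: "2 powr log 2 k = k" using assms by simp
  have "real k \<le> 2 powr L" using powr_mono[OF L(1), of 2] k by simp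
  then have "real k \<le> 2 ^ L" by (simp add: powr_realpow)
  then show "k \<le> 2 ^ nat \<lceil>log 2 (real k)\<rceil>"
    unfolding L_def[symmetric] by (metis of_nat_le_iff of_nat_numeral of_nat_power)
  have "2 powr L < 2 powr (log 2 k + 1)" using L(2) by (intro powr_less_mono) auto
  then have "(2::real) ^ L < 2 * k" using k by (simp add: powr_realpow powr_add)
  then have "real (2 ^ L) < real (2 * k)" by simp
  then show "2 ^ nat \<lceil>log 2 (real k)\<rceil> < 2 * k"
    unfolding L_def[symmetric] by (simp only: of_nat_less_iff)
qed

lemma two_mult_le_fact: "k \<ge> 4 \<Longrightarrow> 2 * k \<le> fact k"
proof (induction k rule: nat_induct_at_least)
  case base
  show ?case by (simp add: fact_numeral)
next
  case (Suc k)
  have "2 * Suc k \<le> Suc k * (2 * k)" using Suc.hyps by simp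
  also have "\<dots> \<le> Suc k * fact k" using Suc.IH by (rule mult_left_mono) simp
  finally show ?case by simp
qed

theorem theorem1p3:
  fixes k t :: nat
  assumes "k \<ge> 4" and "t \<ge> 1"
  shows "(t \<le> 2 \<longrightarrow> (\<forall>n\<ge>k. shatter_num k n t = t)) \<and>
    (3 \<le> t \<and> t \<le> 2 ^ nat \<lceil>log 2 (real k)\<rceil> \<longrightarrow>
      (\<lambda>n. real (shatter_num k n t)) \<in> \<Theta>(\<lambda>n. ln (ln (real n)))) \<and>
    (2 ^ nat \<lceil>log 2 (real k)\<rceil> < t \<and> t \<le> min (2 * k) (2 ^ nat \<lceil>log 2 (real k)\<rceil> + 4) \<longrightarrow>
      (\<lambda>n. real (shatter_num k n t)) \<in> \<Theta>(\<lambda>n. sqrt (ln (real n)))) \<and>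
    (2 ^ (k - 1) < t \<and> t \<le> fact k \<longrightarrow>
      (\<lambda>n. real (shatter_num k n t)) \<in> \<Theta>(\<lambda>n. ln (real n)))"
proof -
  define L where "L = nat \<lceil>log 2 (real k)\<rceil>"
  have L: "k \<le> 2 ^ L" "2 ^ L < 2 * k" using ceiling_log_bounds[of k] assms(1) unfolding L_def by auto
  have fact: "2 * k \<le> fact k" using two_mult_le_fact assms(1) .
  have "shatter_num k n t = t" if "t \<le> 2" "n \<ge> k" for n
    using that assms by (intro shatter_num_small) auto
  moreover have "(\<lambda>n. real (shatter_num k n t)) \<in> \<Theta>(\<lambda>n. ln (ln (real n)))" if "3 \<le> t" "t \<le> 2 ^ L"
    using that L fact assms by (intro shatter_num_loglog_regime) auto
  moreover have "(\<lambda>n. real (shatter_num k n t)) \<in> \<Theta>(\<lambda>n. sqrt (ln (real n)))"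
    if "2 ^ L < t" "t \<le> 2 * k" "t \<le> 2 ^ L + 4"
    using that L fact assms by (intro shatter_num_sqrt_log_regime) auto
  moreover have "(\<lambda>n. real (shatter_num k n t)) \<in> \<Theta>(\<lambda>n. ln (real n))" if "2 ^ (k - 1) < t" "t \<le> fact k"
    using that assms by (intro shatter_num_log_regime) auto
  ultimately show ?thesis unfolding L_def by (simp only: min.bounded_iff) blast
qed

end
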